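(* Let $\mathcal L$ be a locally geometric semilattice and let $r$ be the largest rank of an element of $\mathcal L$. The differential $\delta$ of the flag complex makes $\mathscr F\ell^{\,\cdot}$ a cochain complex of sheaves on $\mathcal L$. The augmented complex $$0\to\mathscr K\to\mathscr F\ell^{\,0}\xrightarrow{\ \delta\ }\cdots\xrightarrow{\ \delta\ }\mathscr F\ell^{\,i}\xrightarrow{\ \delta\ }\cdots\xrightarrow{\ \delta\ }\mathscr F\ell^{\,r}\to0$$ is flasque (each sheaf $\mathscr F\ell^{\,i}$ is flasque) and exact, where $\mathscr K(x)=\mathbb Q$ for $x=\hat 0$ and $\mathscr K(x)=0$ otherwise.
   Context: A locally geometric semilattice is a finite meet-semilattice $\mathcal L$ (with least element $\hat 0$) such that $\mathcal L_{\le x}=[\hat 0,x]$ is a geometric lattice for every $x$; it is ranked, and $\mathcal L_j$ denotes the set of elements of rank $j$. Sheaves on posets: a finite poset $P$ is topologized with open sets the order ideals (downward-closed sets); a sheaf is equivalent to a family of stalks $\mathscr F(x)=\mathscr F(P_{\le x})$ with restriction maps $\mathscr F(y)\to\mathscr F(x)$ for $x\le y$. Flag complex: $\mathrm{Fl}^i(\mathcal L)$ is the $\mathbb Q$-span of chains $(y_0<y_1<\dots<y_i)$ with $y_j\in\mathcal L_j$, modulo the relations $\sum_y (y_0<\dots<y_{j-1}<y<y_{j+1}<\dots<y_i)=0$, for each such chain and $0<j<i$, the sum being over all $y\in\mathcal L_j$ with $y_{j-1}<y<y_{j+1}$. The differential is $\delta(y_0<\dots<y_i)=(-1)^i\sum_{y_{i+1}}(y_0<\dots<y_i<y_{i+1})$,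 sum over $y_{i+1}\in\mathcal L_{i+1}$ with $y_{i+1}>y_i$. There is a decomposition $\mathrm{Fl}^i(\mathcal L)\cong\bigoplus_{x\in\mathcal L_i}\mathrm{Fl}^i(\mathcal L_{\le x})$ by the top element of the chain. The sheaf $\mathscr F\ell^{\,i}$ on $\mathcal L$ has $\mathscr F\ell^{\,i}(x)=\mathrm{Fl}^i(\mathcal L_{\le x})$, with restriction maps $\mathrm{Fl}^i(\mathcal L_{\le x_1})\to\mathrm{Fl}^i(\mathcal L_{\le x_0})$ for $x_0\le x_1$ the coordinate projections with respect to this decomposition (a chain is sent to itself if its top element is $\le x_0$ and to $0$ otherwise). The differential on stalks at $x$ is $\delta$ for $\mathcal L_{\le x}$. *)

theory Defs
  imports "HOL-Algebra.Module" "HOL-Algebra.AbelCoset" "HOL-Library.Lub_Glb" "HOL-Library.FuncSet"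
begin

section \<open>Locally geometric semilattices\<close>

text \<open>
  A poset is a subset \<open>P\<close> of a partially ordered type, with the induced order.  All lattice
  notions are relative to \<open>P\<close>: \<open>isLub P A z\<close> says that \<open>z\<close> is the least upper bound of \<open>A\<close>
  among the elements of \<open>P\<close>.
\<close>

definition covers_in :: "'a::order set \<Rightarrow> 'a \<Rightarrow> 'a \<Rightarrow> bool" where
  "covers_in P x y \<longleftrightarrow> x \<in> P \<and> y \<in> P \<and> x < y \<and> \<not> (\<exists>z\<in>P. x < z \<and> z < y)"

definition bottom_of :: "'a::order set \<Rightarrow> 'a" where
  "bottom_of P = (LEAST b. b \<in> P)"

definition atoms_of :: "'a::order set \<Rightarrow> 'a set" where
  "atoms_of P = {a. covers_in P (bottom_of P) a}"

definition finite_lattice_on :: "'a::order set \<Rightarrow> bool" where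
  "finite_lattice_on P \<longleftrightarrow> finite P \<and> P \<noteq> {} \<and>
     (\<forall>x\<in>P. \<forall>y\<in>P. (\<exists>m. isGlb P {x, y} m) \<and> (\<exists>j. isLub P {x, y} j))"

text \<open>Upper semimodularity: if \<open>x\<close> covers \<open>x \<and> y\<close>, then \<open>x \<or> y\<close> covers \<open>y\<close>.\<close>

definition semimodular_on :: "'a::order set \<Rightarrow> bool" where
  "semimodular_on P \<longleftrightarrow>
     (\<forall>x\<in>P. \<forall>y\<in>P. \<forall>m j. isGlb P {x, y} m \<longrightarrow> isLub P {x, y} j \<longrightarrow>
        covers_in P m x \<longrightarrow> covers_in P y j)"

definition atomistic_on :: "'a::order set \<Rightarrow> bool" where
  "atomistic_on P \<longleftrightarrow> (\<forall>x\<in>P. \<exists>A. A \<subseteq> atoms_of P \<and> isLub P A x)"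

definition geometric_lattice_on :: "'a::order set \<Rightarrow> bool" where
  "geometric_lattice_on P \<longleftrightarrow> finite_lattice_on P \<and> semimodular_on P \<and> atomistic_on P"

definition below :: "'a::order set \<Rightarrow> 'a \<Rightarrow> 'a set" where
  "below P x = {y \<in> P. y \<le> x}"

definition locally_geometric_semilattice :: "'a::order set \<Rightarrow> bool" where
  "locally_geometric_semilattice L \<longleftrightarrow>
     finite L \<and> (\<exists>b\<in>L. \<forall>y\<in>L. b \<le> y) \<and>
     (\<forall>x\<in>L. \<forall>y\<in>L. \<exists>m. isGlb L {x, y} m) \<and>
     (\<forall>x\<in>L. geometric_lattice_on (below L x))"

text \<open>The rank of \<open>x\<close> is the length of a longest chain in \<open>P\<close> ending in \<open>x\<close>, that is, the
  largest size of a chain of elements strictly below \<open>x\<close>.\<close>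

definition rank_in :: "'a::order set \<Rightarrow> 'a \<Rightarrow> nat" where
  "rank_in P x = Max (card ` {C. C \<subseteq> {y \<in> P. y < x} \<and> Complete_Partial_Order.chain (\<le>) C})"


section \<open>Rational vector spaces\<close>

definition rat_field :: "rat ring" where
  "rat_field = \<lparr>carrier = UNIV, mult = (*), one = 1, zero = 0, add = (+)\<rparr>"

definition linear_map ::
  "(rat, 'b) module \<Rightarrow> (rat, 'c) module \<Rightarrow> ('b \<Rightarrow> 'c) \<Rightarrow> bool" where
  "linear_map M N h \<longleftrightarrow>
     h \<in> carrier M \<rightarrow> carrier N \<and>
     (\<forall>u\<in>carrier M. \<forall>v\<in>carrier M. h (u \<oplus>\<^bsub>M\<^esub> v) = h u \<oplus>\<^bsub>N\<^esub> h v) \<and>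
     (\<forall>q. \<forall>v\<in>carrier M. h (q \<odot>\<^bsub>M\<^esub> v) = q \<odot>\<^bsub>N\<^esub> h v)"

text \<open>The type of modules extends that of rings; the fields \<open>mult\<close> and \<open>one\<close> of a module play
  no role and are left undefined.\<close>

definition free_space :: "'c set \<Rightarrow> (rat, 'c \<Rightarrow> rat) module" where
  "free_space S =
     \<lparr>carrier = {f. finite {c. f c \<noteq> 0} \<and> {c. f c \<noteq> 0} \<subseteq> S},
      mult = undefined, one = undefined,
      zero = (\<lambda>_. 0), add = (\<lambda>f g c. f c + g c), smult = (\<lambda>q f c. q * f c)\<rparr>"

definition basis_vec :: "'c \<Rightarrow> 'c \<Rightarrow> rat" where
  "basis_vec c = (\<lambda>d. if d = c then 1 else 0)"

definition linear_ext :: "'c set \<Rightarrow> ('c \<Rightarrow> 'd \<Rightarrow> rat) \<Rightarrow> ('c \<Rightarrow> rat) \<Rightarrow> ('d \<Rightarrow> rat)" where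
  "linear_ext S g f = (\<lambda>d. \<Sum>c\<in>S. f c * g c d)"

definition span_in :: "(rat, 'b) module \<Rightarrow> 'b set \<Rightarrow> 'b set" where
  "span_in M G = \<Inter>{H. submodule H rat_field M \<and> G \<subseteq> H}"

definition quotient_space :: "(rat, 'b) module \<Rightarrow> 'b set \<Rightarrow> (rat, 'b set) module" where
  "quotient_space M H =
     \<lparr>carrier = a_rcosets\<^bsub>M\<^esub> H,
      mult = undefined, one = undefined,
      zero = H, add = set_add M, smult = (\<lambda>q X. \<Union>v\<in>X. H +>\<^bsub>M\<^esub> (q \<odot>\<^bsub>M\<^esub> v))\<rparr>"

text \<open>The map induced by \<open>h\<close> on cosets, with values in \<open>N / H\<close>.  The union is a single coset
  exactly if \<open>h\<close> is constant modulo \<open>H\<close> on \<open>X\<close>; so well-definedness of an induced map is part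
  of the claim that it maps into the quotient.\<close>

definition induced_map :: "(rat, 'c) module \<Rightarrow> 'c set \<Rightarrow> ('b \<Rightarrow> 'c) \<Rightarrow> 'b set \<Rightarrow> 'c set" where
  "induced_map N H h X = (\<Union>v\<in>X. H +>\<^bsub>N\<^esub> h v)"


section \<open>Sheaves on finite posets\<close>

text \<open>
  The open sets of \<open>P\<close> are its order ideals.  A sheaf of rational vector spaces is given by its
  stalks \<open>stalk F x\<close>, which are the sections over the smallest open neighbourhood of \<open>x\<close>, and by
  restriction maps \<open>res F y x\<close> from the stalk at \<open>y\<close> to the stalk at \<open>x\<close>, for \<open>x \<le> y\<close>.
  The sections over an order ideal are the compatible families of stalk elements.
\<close>

record ('p, 'b) poset_sheaf =
  stalk :: "'p \<Rightarrow> (rat, 'b) module"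
  res :: "'p \<Rightarrow> 'p \<Rightarrow> 'b \<Rightarrow> 'b"

definition sheaf_on :: "'p::order set \<Rightarrow> ('p, 'b) poset_sheaf \<Rightarrow> bool" where
  "sheaf_on P F \<longleftrightarrow>
     (\<forall>x\<in>P. Module.module rat_field (stalk F x)) \<and>
     (\<forall>x\<in>P. \<forall>y\<in>P. x \<le> y \<longrightarrow> linear_map (stalk F y) (stalk F x) (res F y x)) \<and>
     (\<forall>x\<in>P. \<forall>s\<in>carrier (stalk F x). res F x x s = s) \<and>
     (\<forall>x\<in>P. \<forall>y\<in>P. \<forall>z\<in>P. x \<le> y \<longrightarrow> y \<le> z \<longrightarrow>
        (\<forall>s\<in>carrier (stalk F z). res F y x (res F z y s) = res F z x s))"

definition sheaf_hom ::
  "'p::order set \<Rightarrow> ('p, 'b) poset_sheaf \<Rightarrow> ('p, 'c) poset_sheaf \<Rightarrow> ('p \<Rightarrow> 'b \<Rightarrow> 'c) \<Rightarrow> bool" where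
  "sheaf_hom P F G h \<longleftrightarrow>
     (\<forall>x\<in>P. linear_map (stalk F x) (stalk G x) (h x)) \<and>
     (\<forall>x\<in>P. \<forall>y\<in>P. x \<le> y \<longrightarrow>
        (\<forall>s\<in>carrier (stalk F y). h x (res F y x s) = res G y x (h y s)))"

definition order_ideal :: "'p::order set \<Rightarrow> 'p set \<Rightarrow> bool" where
  "order_ideal P U \<longleftrightarrow> U \<subseteq> P \<and> (\<forall>x\<in>U. \<forall>y\<in>P. y \<le> x \<longrightarrow> y \<in> U)"

definition sections :: "('p::order, 'b) poset_sheaf \<Rightarrow> 'p set \<Rightarrow> ('p \<Rightarrow> 'b) set" where
  "sections F U =
     {s \<in> (\<Pi>\<^sub>E x\<in>U. carrier (stalk F x)). \<forall>x\<in>U. \<forall>y\<in>U. x \<le> y \<longrightarrow> res F y x (s y) = s x}"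

lemma sections_below:
  assumes F: "sheaf_on P F" and x: "x \<in> P"
  shows "bij_betw (\<lambda>s. s x) (sections F (below P x)) (carrier (stalk F x))"
proof (rule bij_betw_byWitness[where f' = "\<lambda>t. \<lambda>y\<in>below P x. res F x y t"])
  show "\<forall>s\<in>sections F (below P x). (\<lambda>y\<in>below P x. res F x y (s x)) = s"
  proof
    fix s assume s: "s \<in> sections F (below P x)"
    show "(\<lambda>y\<in>below P x. res F x y (s x)) = s"
    proof
      fix y show "(\<lambda>y\<in>below P x. res F x y (s x)) y = s y"
        using s x by (auto simp: sections_def below_def PiE_def extensional_def)
    qed
  qed
  show "\<forall>t\<in>carrier (stalk F x). (\<lambda>y\<in>below P x. res F x y t) x = t"
    using F x by (auto simp: sheaf_on_def below_def)
  show "(\<lambda>s. s x) ` sections F (below P x) \<subseteq> carrier (stalk F x)"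
    using x by (auto simp: sections_def below_def)
  show "(\<lambda>t. \<lambda>y\<in>below P x. res F x y t) ` carrier (stalk F x) \<subseteq> sections F (below P x)"
  proof (rule image_subsetI)
    fix t assume t: "t \<in> carrier (stalk F x)"
    have "res F x y t \<in> carrier (stalk F y)" if "y \<in> P" "y \<le> x" for y
      using F x t that unfolding sheaf_on_def linear_map_def by blast
    moreover have "res F z y (res F x z t) = res F x y t"
      if "y \<in> P" "z \<in> P" "y \<le> z" "z \<le> x" for y z
      using F x t that unfolding sheaf_on_def by blast
    ultimately show "(\<lambda>y\<in>below P x. res F x y t) \<in> sections F (below P x)"
      by (auto simp: sections_def below_def)
  qed
qed

definition flasque :: "'p::order set \<Rightarrow> ('p, 'b) poset_sheaf \<Rightarrow> bool" where
  "flasque P F \<longleftrightarrow>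
     (\<forall>U V. order_ideal P U \<longrightarrow> order_ideal P V \<longrightarrow> V \<subseteq> U \<longrightarrow>
        (\<lambda>s. restrict s V) ` sections F U = sections F V)"

definition sheaf_complex ::
  "'p::order set \<Rightarrow> (nat \<Rightarrow> ('p, 'b) poset_sheaf) \<Rightarrow> (nat \<Rightarrow> 'p \<Rightarrow> 'b \<Rightarrow> 'b) \<Rightarrow> bool" where
  "sheaf_complex P F d \<longleftrightarrow>
     (\<forall>i. sheaf_on P (F i)) \<and>
     (\<forall>i. sheaf_hom P (F i) (F (Suc i)) (d i)) \<and>
     (\<forall>i. \<forall>x\<in>P. \<forall>s\<in>carrier (stalk (F i) x).
        d (Suc i) x (d i x s) = \<zero>\<^bsub>stalk (F (Suc (Suc i))) x\<^esub>)"

text \<open>Exactness of \<open>0 \<rightarrow> K \<rightarrow> F 0 \<rightarrow> \<dots> \<rightarrow> F n \<rightarrow> 0\<close>, with first map \<open>e\<close> and further maps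
  \<open>d 0, \<dots>, d (n - 1)\<close>, tested on stalks.  The map out of \<open>F n\<close> is zero, so its kernel is the
  whole stalk.\<close>

definition exact_augmented ::
  "'p::order set \<Rightarrow> nat \<Rightarrow> ('p, 'c) poset_sheaf \<Rightarrow> ('p \<Rightarrow> 'c \<Rightarrow> 'b) \<Rightarrow>
   (nat \<Rightarrow> ('p, 'b) poset_sheaf) \<Rightarrow> (nat \<Rightarrow> 'p \<Rightarrow> 'b \<Rightarrow> 'b) \<Rightarrow> bool" where
  "exact_augmented P n K e F d \<longleftrightarrow>
     (\<forall>x\<in>P. a_kernel (stalk K x) (stalk (F 0) x) (e x) = {\<zero>\<^bsub>stalk K x\<^esub>}) \<and>
     (\<forall>i\<le>n. \<forall>x\<in>P.
        (if i = 0 then e x ` carrier (stalk K x)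
         else d (i - 1) x ` carrier (stalk (F (i - 1)) x)) =
        (if i = n then carrier (stalk (F i) x)
         else a_kernel (stalk (F i) x) (stalk (F (Suc i)) x) (d i x)))"


section \<open>The flag complex and the flag sheaves\<close>

text \<open>A chain \<open>y\<^sub>0 < \<dots> < y\<^sub>i\<close> is the list of its elements in increasing order.\<close>

definition flags :: "'a::order set \<Rightarrow> nat \<Rightarrow> 'a list set" where
  "flags P i =
     {c. length c = Suc i \<and> sorted_wrt (<) c \<and> (\<forall>j\<le>i. c ! j \<in> P \<and> rank_in P (c ! j) = j)}"

definition flag_relators :: "'a::order set \<Rightarrow> nat \<Rightarrow> ('a list \<Rightarrow> rat) set" where
  "flag_relators P i =
     {(\<lambda>d. \<Sum>y | y \<in> P \<and> rank_in P y = j \<and> c ! (j - 1) < y \<and> y < c ! (j + 1).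
              basis_vec (c[j := y]) d) | c j. c \<in> flags P i \<and> 0 < j \<and> j < i}"

definition flag_relations :: "'a::order set \<Rightarrow> nat \<Rightarrow> ('a list \<Rightarrow> rat) set" where
  "flag_relations P i = span_in (free_space (flags P i)) (flag_relators P i)"

definition flag_space :: "'a::order set \<Rightarrow> nat \<Rightarrow> (rat, ('a list \<Rightarrow> rat) set) module" where
  "flag_space P i = quotient_space (free_space (flags P i)) (flag_relations P i)"

definition flag_differential ::
  "'a::order set \<Rightarrow> nat \<Rightarrow> ('a list \<Rightarrow> rat) set \<Rightarrow> ('a list \<Rightarrow> rat) set" where
  "flag_differential P i =
     induced_map (free_space (flags P (Suc i))) (flag_relations P (Suc i))
       (linear_ext (flags P i)
          (\<lambda>c d. (-1) ^ i *
             (\<Sum>y | y \<in> P \<and> rank_in P y = Suc i \<and> last c < y. basis_vec (c @ [y]) d)))"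

definition flag_projection ::
  "'a::order set \<Rightarrow> nat \<Rightarrow> 'a \<Rightarrow> 'a \<Rightarrow> ('a list \<Rightarrow> rat) set \<Rightarrow> ('a list \<Rightarrow> rat) set" where
  "flag_projection L i x1 x0 =
     induced_map (free_space (flags (below L x0) i)) (flag_relations (below L x0) i)
       (linear_ext (flags (below L x1) i)
          (\<lambda>c. if last c \<le> x0 then basis_vec c else (\<lambda>_. 0)))"

definition flag_sheaf :: "'a::order set \<Rightarrow> nat \<Rightarrow> ('a, ('a list \<Rightarrow> rat) set) poset_sheaf" where
  "flag_sheaf L i = \<lparr>stalk = (\<lambda>x. flag_space (below L x) i), res = flag_projection L i\<rparr>"

definition flag_sheaf_differential ::
  "'a::order set \<Rightarrow> nat \<Rightarrow> 'a \<Rightarrow> ('a list \<Rightarrow> rat) set \<Rightarrow> ('a list \<Rightarrow> rat) set" where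
  "flag_sheaf_differential L i x = flag_differential (below L x) i"

text \<open>The sheaf with stalk \<open>\<rat>\<close> at the least element and \<open>0\<close> elsewhere, and its
  map to the flag sheaf in degree \<open>0\<close>, which sends \<open>1\<close> at the least element to the class of the
  one-element chain.\<close>

definition bottom_sheaf :: "'a::order set \<Rightarrow> ('a, rat) poset_sheaf" where
  "bottom_sheaf L =
     \<lparr>stalk = (\<lambda>x. \<lparr>carrier = (if x = bottom_of L then UNIV else {0}),
                   mult = undefined, one = undefined, zero = 0, add = (+), smult = (*)\<rparr>),
      res = (\<lambda>y x q. if x = y then q else 0)\<rparr>"

definition augmentation :: "'a::order set \<Rightarrow> 'a \<Rightarrow> rat \<Rightarrow> ('a list \<Rightarrow> rat) set" where
  "augmentation L x q =
     flag_relations (below L x) 0 +>\<^bsub>free_space (flags (below L x) 0)\<^esub>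
       (\<lambda>c. q * basis_vec [bottom_of L] c)"

end

theory Submission
  imports Defs
begin

text \<open>
  Identify an element of the free space on the flags with a function \<open>f\<close> on flags.  The relations are
  then spanned by the functions that do not depend on one given entry \<open>p\<close> with \<open>0 < p < i\<close>,
  and \<open>(\<delta> f) (d) = \<plusminus> f (d without its top)\<close>; both are local conditions that restrict well.

  For exactness at \<open>x \<noteq> bottom\<close> fix an atom \<open>a \<le> x\<close>.  The dual of multiplication by \<open>a\<close> in the
  Orlik-Solomon algebra is \<open>(h f) (z) = \<Sum>k. (-1)\<^sup>k f (z\<^sub>0, \<dots>, z\<^sub>k, z\<^sub>k \<or> a, \<dots>, z\<^sub>i \<or> a)\<close> if \<open>a\<close> is not
  below \<open>z\<^sub>i\<close>, and \<open>0\<close> otherwise.  It respects the relations, and \<open>\<delta> h + h \<delta> = id\<close> holds on the nose for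
  functions supported on the flags with \<open>a\<close> not below \<open>z\<^bsub>i-1\<^esub>\<close>; every function is congruent to such a
  one modulo the relations.  Flasqueness holds because sections over an ideal are given by arbitrary
  data on its elements of rank \<open>i\<close>.
\<close>

section \<open>Quotients of free spaces\<close>

text \<open>The homotopy formula is the transpose of the Leibniz rule in the Orlik-Solomon algebra:
  the derivation after multiplication by \<open>e\<^sub>a\<close>, plus multiplication after the
  derivation, is the identity. Multiplication by \<open>e\<^sub>a\<close> kills the component of
  every element above \<open>a\<close>, whence the value 0 of \<open>h f\<close> at flags whose top
  is above \<open>a\<close>. On representatives, both summands therefore vanish at every flag with
  \<open>a\<close> below the entry under its top, and the identity fails there unless
  \<open>f\<close> is 0. This obstacle forces the passage to a congruent function. The relations are
  used one-sidedly: apart from low degrees, where there are none, membership in them is only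
  produced, by constancy at an inner entry, and transported along linear maps. Hence neither a basis
  of the flag spaces nor the duality itself enters the proof. The bottom has no atom below it. Its
  stalks of positive degree are zero and its stalk of degree 0 is a copy of \<rat>, which is what
  \<open>K\<close> accounts for.\<close>

lemma carrier_rat_field [simp]: "carrier rat_field = UNIV"
  by (simp add: rat_field_def)

lemma cring_rat_field: "cring rat_field"
  unfolding rat_field_def
  by (rule cringI[OF abelian_groupI comm_monoidI]) (auto simp: algebra_simps intro: exI[of _ "- x" for x])

lemma free_space_sel [simp]:
  "zero (free_space S) = (\<lambda>_. 0)"
  "add (free_space S) = (\<lambda>f g c. f c + g c)"
  "smult (free_space S) = (\<lambda>q f c. q * f c)"
  by (simp_all add: free_space_def)

lemma mem_free_space_iff:
  "finite S \<Longrightarrow> f \<in> carrier (free_space S) \<longleftrightarrow> (\<forall>c. c \<notin> S \<longrightarrow> f c = 0)"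
  by (auto simp: free_space_def intro: finite_subset)

lemma add_in_free_space:
  assumes "f \<in> carrier (free_space S)" "g \<in> carrier (free_space S)"
  shows "(\<lambda>c. f c + g c) \<in> carrier (free_space S)"
proof -
  have "{c. f c + g c \<noteq> 0} \<subseteq> {c. f c \<noteq> 0} \<union> {c. g c \<noteq> 0}"
    by auto
  with assms show ?thesis
    by (auto simp: free_space_def intro: finite_subset)
qed

lemma smult_in_free_space:
  assumes "f \<in> carrier (free_space S)"
  shows "(\<lambda>c. q * f c) \<in> carrier (free_space S)"
proof -
  have "{c. q * f c \<noteq> 0} \<subseteq> {c. f c \<noteq> 0}"
    by auto
  with assms show ?thesis
    by (auto simp: free_space_def intro: finite_subset)
qed

lemma module_free_space: "Module.module rat_field (free_space S)"
proof (rule moduleI[OF cring_rat_field abelian_groupI])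
  fix f assume f: "f \<in> carrier (free_space S)"
  show "\<exists>g\<in>carrier (free_space S). g \<oplus>\<^bsub>free_space S\<^esub> f = \<zero>\<^bsub>free_space S\<^esub>"
    by (rule bexI[OF _ smult_in_free_space[OF f, of "-1"]]) simp
qed (auto simp: add_in_free_space smult_in_free_space algebra_simps rat_field_def,
     auto simp: free_space_def)

lemma abelian_group_free_space: "abelian_group (free_space S)"
  using module_free_space Module.module_def by blast

lemma a_inv_free_space:
  assumes "f \<in> carrier (free_space S)"
  shows "\<ominus>\<^bsub>free_space S\<^esub> f = (\<lambda>c. - f c)"
proof -
  have "(\<lambda>c. - f c) \<in> carrier (free_space S)"
    using smult_in_free_space[OF assms, of "-1"] by simp
  then show ?thesis
    using abelian_group.minus_equality[OF abelian_group_free_space _ assms, of "\<lambda>c. - f c"] assms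
    by simp
qed

lemma submodule_freeI:
  assumes "H \<subseteq> carrier (free_space S)" "(\<lambda>_. 0) \<in> H"
    and add: "\<And>f g. f \<in> H \<Longrightarrow> g \<in> H \<Longrightarrow> (\<lambda>c. f c + g c) \<in> H"
    and smult: "\<And>q f. f \<in> H \<Longrightarrow> (\<lambda>c. q * f c) \<in> H"
  shows "submodule H rat_field (free_space S)"
proof (rule module.submoduleI[OF module_free_space assms(1)])
  fix f assume f: "f \<in> H"
  then have "\<ominus>\<^bsub>free_space S\<^esub> f = (\<lambda>c. - f c)"
    using assms(1) by (intro a_inv_free_space) blast
  with smult[OF f, of "-1"] show "\<ominus>\<^bsub>free_space S\<^esub> f \<in> H"
    by simp
qed (use assms in auto)

section \<open>Cosets of a subspace and the quotient they form\<close>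

context
  fixes S :: "'c set" and H :: "('c \<Rightarrow> rat) set"
  assumes H: "submodule H rat_field (free_space S)"
begin

lemma submodule_free_subset: "f \<in> H \<Longrightarrow> f \<in> carrier (free_space S)"
  using module.submoduleE(1)[OF module_free_space H] by blast

lemma submodule_free_zero: "(\<lambda>_. 0) \<in> H"
  using subgroup.one_closed[OF submodule.axioms(1)[OF H]] by simp

lemma submodule_free_add: "f \<in> H \<Longrightarrow> g \<in> H \<Longrightarrow> (\<lambda>c. f c + g c) \<in> H"
  using module.submoduleE(5)[OF module_free_space H, of f g] by simp

lemma submodule_free_smult: "f \<in> H \<Longrightarrow> (\<lambda>c. q * f c) \<in> H"
  using module.submoduleE(4)[OF module_free_space H, of q f] by simp

lemma submodule_free_diff: "f \<in> H \<Longrightarrow> g \<in> H \<Longrightarrow> (\<lambda>c. f c - g c) \<in> H"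
  using submodule_free_add[OF _ submodule_free_smult, of f g "-1"] by simp

lemma submodule_free_sum:
  "(\<And>i. i \<in> I \<Longrightarrow> f i \<in> H) \<Longrightarrow> (\<lambda>c. \<Sum>i\<in>I. f i c) \<in> H"
  by (induction I rule: infinite_finite_induct) (auto intro: submodule_free_zero submodule_free_add)

lemma mem_coset_iff:
  assumes "v \<in> carrier (free_space S)"
  shows "u \<in> H +>\<^bsub>free_space S\<^esub> v \<longleftrightarrow> (\<lambda>c. u c - v c) \<in> H"
proof -
  have "u = (\<lambda>c. x c + v c) \<longleftrightarrow> x = (\<lambda>c. u c - v c)" for x
    by (auto simp: fun_eq_iff algebra_simps)
  then show ?thesis
    by (auto simp: a_r_coset_def')
qed

lemma coset_eq_iff:
  assumes "v \<in> carrier (free_space S)" "w \<in> carrier (free_space S)"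
  shows "H +>\<^bsub>free_space S\<^esub> v = H +>\<^bsub>free_space S\<^esub> w \<longleftrightarrow> (\<lambda>c. v c - w c) \<in> H"
proof
  assume "H +>\<^bsub>free_space S\<^esub> v = H +>\<^bsub>free_space S\<^esub> w"
  moreover have "v \<in> H +>\<^bsub>free_space S\<^esub> v"
    using submodule_free_zero assms by (simp add: mem_coset_iff)
  ultimately show "(\<lambda>c. v c - w c) \<in> H"
    using assms mem_coset_iff by blast
next
  assume d: "(\<lambda>c. v c - w c) \<in> H"
  show "(H +>\<^bsub>free_space S\<^esub> v) = (H +>\<^bsub>free_space S\<^esub> w)"
  proof (rule Set.set_eqI)
    fix u
    show "u \<in> H +>\<^bsub>free_space S\<^esub> v \<longleftrightarrow> u \<in> H +>\<^bsub>free_space S\<^esub> w"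
      using submodule_free_add[OF _ d, of "\<lambda>c. u c - v c"]
        submodule_free_diff[OF _ d, of "\<lambda>c. u c - w c"] assms
      by (auto simp: mem_coset_iff)
  qed
qed

lemma coset_zero: "H +>\<^bsub>free_space S\<^esub> (\<lambda>_. 0) = H"
  by (simp add: a_r_coset_def')

lemma coset_eq_self_iff:
  assumes "v \<in> carrier (free_space S)"
  shows "H +>\<^bsub>free_space S\<^esub> v = H \<longleftrightarrow> v \<in> H"
  using coset_eq_iff[OF assms submodule_free_subset[OF submodule_free_zero]]
  by (simp add: coset_zero)

lemma set_add_cosets:
  assumes "v \<in> carrier (free_space S)" "w \<in> carrier (free_space S)"
  shows "set_add (free_space S) (H +>\<^bsub>free_space S\<^esub> v) (H +>\<^bsub>free_space S\<^esub> w)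
    = H +>\<^bsub>free_space S\<^esub> (\<lambda>c. v c + w c)"
proof -
  have "abelian_subgroup H (free_space S)"
    using abelian_group_free_space submodule.axioms(1)[OF H]
    by (intro abelian_subgroupI3 additive_subgroup.intro)
  from abelian_subgroup.a_rcos_sum[OF this assms] show ?thesis
    by simp
qed

text \<open>Scalar multiples and induced maps on a quotient are defined as unions over a coset.
  Well-definedness, which is the second assumption, collapses such a union to a single
  value.\<close>

lemma UN_coset:
  assumes v: "v \<in> carrier (free_space S)"
    and "\<And>u. u \<in> carrier (free_space S) \<Longrightarrow> (\<lambda>c. u c - v c) \<in> H \<Longrightarrow> F u = F v"
  shows "(\<Union>u\<in>H +>\<^bsub>free_space S\<^esub> v. F u) = F v"
proof -
  have "u \<in> carrier (free_space S)" if "(\<lambda>c. u c - v c) \<in> H" for u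
    using add_in_free_space[OF submodule_free_subset[OF that] v] by simp
  then have "F u = F v" if "u \<in> H +>\<^bsub>free_space S\<^esub> v" for u
    using that assms by (simp add: mem_coset_iff)
  moreover have "v \<in> H +>\<^bsub>free_space S\<^esub> v"
    using v submodule_free_zero by (simp add: mem_coset_iff)
  ultimately show ?thesis
    by blast
qed

lemma smult_coset:
  assumes v: "v \<in> carrier (free_space S)"
  shows "q \<odot>\<^bsub>quotient_space (free_space S) H\<^esub> (H +>\<^bsub>free_space S\<^esub> v)
    = H +>\<^bsub>free_space S\<^esub> (\<lambda>c. q * v c)"
  unfolding quotient_space_def module.simps free_space_sel
proof (rule UN_coset[OF v])
  fix u assume "u \<in> carrier (free_space S)" "(\<lambda>c. u c - v c) \<in> H"
  with submodule_free_smult[OF this(2), of q]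
  show "H +>\<^bsub>free_space S\<^esub> (\<lambda>c. q * u c) = H +>\<^bsub>free_space S\<^esub> (\<lambda>c. q * v c)"
    by (subst coset_eq_iff) (auto intro: smult_in_free_space v simp: algebra_simps)
qed

lemma add_coset:
  assumes "v \<in> carrier (free_space S)" "w \<in> carrier (free_space S)"
  shows "(H +>\<^bsub>free_space S\<^esub> v) \<oplus>\<^bsub>quotient_space (free_space S) H\<^esub> (H +>\<^bsub>free_space S\<^esub> w)
    = H +>\<^bsub>free_space S\<^esub> (\<lambda>c. v c + w c)"
  using set_add_cosets[OF assms] by (simp add: quotient_space_def)

lemma zero_quotient: "\<zero>\<^bsub>quotient_space (free_space S) H\<^esub> = H"
  by (simp add: quotient_space_def)

lemma carrier_quotient:
  "carrier (quotient_space (free_space S) H) = (\<lambda>v. H +>\<^bsub>free_space S\<^esub> v) ` carrier (free_space S)"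
  by (auto simp: quotient_space_def A_RCOSETS_def')

lemma quotientE:
  assumes "X \<in> carrier (quotient_space (free_space S) H)"
  obtains v where "v \<in> carrier (free_space S)" "X = H +>\<^bsub>free_space S\<^esub> v"
  using assms by (auto simp: carrier_quotient)

lemma module_quotient: "Module.module rat_field (quotient_space (free_space S) H)"
proof (rule moduleI[OF cring_rat_field abelian_groupI])
  let ?Q = "quotient_space (free_space S) H"
  fix X assume "X \<in> carrier ?Q"
  then obtain v where v: "v \<in> carrier (free_space S)" "X = H +>\<^bsub>free_space S\<^esub> v"
    by (rule quotientE)
  have "(H +>\<^bsub>free_space S\<^esub> (\<lambda>c. (-1) * v c)) \<oplus>\<^bsub>?Q\<^esub> X = \<zero>\<^bsub>?Q\<^esub>"
    unfolding v(2) by (subst add_coset) (auto simp: v smult_in_free_space coset_zero zero_quotient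
        intro: smult_in_free_space[of _ _ "-1", simplified])
  then show "\<exists>Y\<in>carrier ?Q. Y \<oplus>\<^bsub>?Q\<^esub> X = \<zero>\<^bsub>?Q\<^esub>"
    using smult_in_free_space[OF v(1), of "-1"] by (auto simp: carrier_quotient intro!: bexI[rotated])
next
  show "\<zero>\<^bsub>quotient_space (free_space S) H\<^esub> \<in> carrier (quotient_space (free_space S) H)"
    using coset_zero submodule_free_subset[OF submodule_free_zero]
    by (force simp: carrier_quotient zero_quotient)
\<comment> \<open>The zero of the quotient is \<open>H\<close> itself, so the neutral law needs
  \<open>add_coset\<close> with \<open>H\<close> read as the coset of the zero function.\<close>
qed (elim quotientE, simp add: add_coset smult_coset zero_quotient add_in_free_space
      smult_in_free_space rat_field_def algebra_simps carrier_quotient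
      add_coset[where v="\<lambda>_. 0", unfolded coset_zero] submodule_free_subset submodule_free_zero)+

end

section \<open>Linear maps on representatives and on quotients\<close>

lemma linear_map_add:
  assumes "linear_map (free_space S) (free_space S') h"
    and "f \<in> carrier (free_space S)" "g \<in> carrier (free_space S)"
  shows "h (\<lambda>c. f c + g c) = (\<lambda>d. h f d + h g d)"
  using assms by (simp add: linear_map_def)

lemma linear_map_smult:
  assumes "linear_map (free_space S) (free_space S') h" and "f \<in> carrier (free_space S)"
  shows "h (\<lambda>c. q * f c) = (\<lambda>d. q * h f d)"
  using assms by (simp add: linear_map_def)

lemma linear_map_in:
  assumes "linear_map (free_space S) (free_space S') h" and "f \<in> carrier (free_space S)"
  shows "h f \<in> carrier (free_space S')"
  using assms by (auto simp: linear_map_def)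

lemma linear_map_diff:
  assumes h: "linear_map (free_space S) (free_space S') h"
    and f: "f \<in> carrier (free_space S)" and g: "g \<in> carrier (free_space S)"
  shows "h (\<lambda>c. f c - g c) = (\<lambda>d. h f d - h g d)"
  using linear_map_add[OF h f smult_in_free_space[OF g, of "-1"]] linear_map_smult[OF h g, of "-1"]
  by simp

lemma induced_map_coset:
  assumes H: "submodule H rat_field (free_space S)" and K: "submodule K rat_field (free_space S')"
    and h: "linear_map (free_space S) (free_space S') h" and HK: "h ` H \<subseteq> K"
    and v: "v \<in> carrier (free_space S)"
  shows "induced_map (free_space S') K h (H +>\<^bsub>free_space S\<^esub> v) = K +>\<^bsub>free_space S'\<^esub> h v"
  unfolding induced_map_def
proof (rule UN_coset[OF H v])
  fix u assume u: "u \<in> carrier (free_space S)" "(\<lambda>c. u c - v c) \<in> H"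
  have "(\<lambda>d. h u d - h v d) = h (\<lambda>c. u c - v c)"
    using linear_map_diff[OF h u(1) v] by simp
  then have "(\<lambda>d. h u d - h v d) \<in> K"
    using HK u(2) by auto
  then show "K +>\<^bsub>free_space S'\<^esub> h u = K +>\<^bsub>free_space S'\<^esub> h v"
    using h u(1) v by (subst coset_eq_iff[OF K]) (auto simp: linear_map_def)
qed

lemma linear_map_induced:
  assumes H: "submodule H rat_field (free_space S)" and K: "submodule K rat_field (free_space S')"
    and h: "linear_map (free_space S) (free_space S') h" and HK: "h ` H \<subseteq> K"
  shows "linear_map (quotient_space (free_space S) H) (quotient_space (free_space S') K)
    (induced_map (free_space S') K h)"
proof -
  note hc = linear_map_in[OF h] and ha = linear_map_add[OF h] and hs = linear_map_smult[OF h]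
  note ind = induced_map_coset[OF assms]
  show ?thesis
    unfolding linear_map_def
    by (auto elim!: quotientE[OF H] simp: ind hc ha hs add_coset[OF H] add_coset[OF K] smult_coset[OF H]
        smult_coset[OF K] add_in_free_space smult_in_free_space carrier_quotient[OF K])
qed

lemma linear_map_linear_ext:
  assumes S: "finite S" and S': "finite S'"
    and g: "\<And>c d. c \<in> S \<Longrightarrow> d \<notin> S' \<Longrightarrow> g c d = 0"
  shows "linear_map (free_space S) (free_space S') (linear_ext S g)"
  using S S' g unfolding linear_map_def
  by (auto simp: mem_free_space_iff linear_ext_def fun_eq_iff sum.distrib distrib_right
      sum_distrib_left mult.assoc)

text \<open>Together with minimality of the span, this reduces "a span is mapped into
  \<open>K\<close>" to a check on generators.\<close>

lemma submodule_vimage: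
  assumes h: "linear_map (free_space S) (free_space S') h"
    and K: "submodule K rat_field (free_space S')"
  shows "submodule {f \<in> carrier (free_space S). h f \<in> K} rat_field (free_space S)"
proof -
  note ha = linear_map_add[OF h] and hs = linear_map_smult[OF h]
  have z: "(\<lambda>_. 0) \<in> carrier (free_space S)"
    by (simp add: free_space_def)
  show ?thesis
    using hs[OF z, of 0] z
    by (intro submodule_freeI)
      (auto simp: ha hs add_in_free_space smult_in_free_space submodule_free_zero[OF K]
        submodule_free_add[OF K] submodule_free_smult[OF K])
qed

lemma submodule_span_in:
  assumes "G \<subseteq> carrier (free_space S)"
  shows "submodule (span_in (free_space S) G) rat_field (free_space S)"
proof (rule submodule_freeI)
  show "span_in (free_space S) G \<subseteq> carrier (free_space S)"
    using assms module.carrier_is_submodule[OF module_free_space] by (auto simp: span_in_def)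
qed (auto simp: span_in_def submodule_free_zero submodule_free_add submodule_free_smult)

lemma span_in_superset: "G \<subseteq> span_in M G"
  by (auto simp: span_in_def)

lemma span_in_least: "submodule H rat_field M \<Longrightarrow> G \<subseteq> H \<Longrightarrow> span_in M G \<subseteq> H"
  by (auto simp: span_in_def)

section \<open>Flags and their relations\<close>

lemma flags_iff:
  "c \<in> flags P i \<longleftrightarrow> length c = Suc i \<and> (\<forall>j\<le>i. c ! j \<in> P \<and> rank_in P (c ! j) = j)
     \<and> (\<forall>j<i. c ! j < c ! Suc j)"
  by (auto simp: flags_def sorted_wrt_iff_nth_Suc_transp)

lemma finite_flags: "finite P \<Longrightarrow> finite (flags P i)"
  by (rule finite_subset[OF _ finite_lists_length_eq[of P "Suc i"]])
    (auto simp: flags_def in_set_conv_nth less_Suc_eq_le)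

lemma length_flag: "c \<in> flags P i \<Longrightarrow> length c = Suc i"
  by (simp add: flags_iff)

lemma last_flag: "c \<in> flags P i \<Longrightarrow> last c = c ! i"
  by (cases c rule: rev_cases) (auto simp: flags_iff nth_append)

lemma snoc_in_flags_iff:
  "c @ [y] \<in> flags P (Suc i) \<longleftrightarrow>
     c \<in> flags P i \<and> y \<in> P \<and> rank_in P y = Suc i \<and> last c < y"
proof (cases "length c = Suc i")
  case True
  then have nth: "(c @ [y]) ! j = (if j = Suc i then y else c ! j)" if "j \<le> Suc i" for j
    using that by (auto simp: nth_append)
  have "last c = c ! i"
    using True by (cases c rule: rev_cases) (auto simp: nth_append)
  moreover have "(\<forall>j<Suc i. (c @ [y]) ! j < (c @ [y]) ! Suc j) \<longleftrightarrow>
      c ! i < y \<and> (\<forall>j<i. c ! j < c ! Suc j)"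
    by (simp add: All_less_Suc nth)
  moreover have "(\<forall>j\<le>Suc i. (c @ [y]) ! j \<in> P \<and> rank_in P ((c @ [y]) ! j) = j) \<longleftrightarrow>
      (y \<in> P \<and> rank_in P y = Suc i) \<and> (\<forall>j\<le>i. c ! j \<in> P \<and> rank_in P (c ! j) = j)"
    by (simp add: All_less_Suc less_Suc_eq_le[symmetric] nth)
  ultimately show ?thesis
    unfolding flags_iff using True by simp argo
qed (auto simp: flags_iff)

lemma flag_SucE:
  assumes "d \<in> flags P (Suc i)"
  obtains c y where "d = c @ [y]" "c \<in> flags P i" "y \<in> P" "rank_in P y = Suc i" "last c < y"
proof -
  from length_flag[OF assms] obtain c y where "d = c @ [y]"
    by (cases d rule: rev_cases) auto
  with assms that show ?thesis
    by (simp add: snoc_in_flags_iff)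
qed

lemma butlast_flag: "d \<in> flags P (Suc i) \<Longrightarrow> butlast d \<in> flags P i"
  by (metis flag_SucE butlast_snoc)

lemma flag_upd_iff:
  assumes c: "c \<in> flags P i" and p: "0 < p" "p < i"
  shows "c[p := y] \<in> flags P i \<longleftrightarrow>
    y \<in> P \<and> rank_in P y = p \<and> c ! (p - 1) < y \<and> y < c ! (p + 1)"
proof
  assume d: "c[p := y] \<in> flags P i"
  then have "c[p := y] ! j < c[p := y] ! Suc j" if "j < i" for j
    using that by (simp add: flags_iff)
  from this[of "p - 1"] this[of p] p c
  have "c ! (p - 1) < y \<and> y < c ! (p + 1)"
    by (simp add: flags_iff nth_list_update)
  moreover have "c[p := y] ! p \<in> P \<and> rank_in P (c[p := y] ! p) = p"
    using d p unfolding flags_iff by (meson less_imp_le)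
  ultimately show "y \<in> P \<and> rank_in P y = p \<and> c ! (p - 1) < y \<and> y < c ! (p + 1)"
    using p c by (simp add: flags_iff)
next
  assume "y \<in> P \<and> rank_in P y = p \<and> c ! (p - 1) < y \<and> y < c ! (p + 1)"
  with c p show "c[p := y] \<in> flags P i"
    by (auto simp: flags_iff nth_list_update)
qed

text \<open>The left side is the convenient way to say that two lists agree off entry
  \<open>p\<close>; the right side makes this relation visibly symmetric and transitive.\<close>

lemma eq_upd_iff:
  "d = c[p := d ! p] \<longleftrightarrow> length d = length c \<and> (\<forall>j<length c. j \<noteq> p \<longrightarrow> d ! j = c ! j)"
proof -
  have "c[p := y] ! j = (if j = p then y else c ! j)" if "j < length c" for j y
    using that by (simp add: nth_list_update)
  then show ?thesis
    unfolding list_eq_iff_nth_eq by (metis length_list_update)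
qed

text \<open>Call the set of flags that agree with a given one off entry \<open>p\<close> a fibre.
  The relators at position \<open>p\<close> are the indicator functions of the fibres, and their
  span consists of the functions described here.\<close>

definition constant_at :: "'a::order set \<Rightarrow> nat \<Rightarrow> nat \<Rightarrow> ('a list \<Rightarrow> rat) \<Rightarrow> bool" where
  "constant_at P i p f \<longleftrightarrow> f \<in> carrier (free_space (flags P i)) \<and>
     (\<forall>c y. c \<in> flags P i \<longrightarrow> c[p := y] \<in> flags P i \<longrightarrow> f (c[p := y]) = f c)"

lemma constant_atD:
  "constant_at P i p f \<Longrightarrow> c \<in> flags P i \<Longrightarrow> d \<in> flags P i \<Longrightarrow> d = c[p := d ! p] \<Longrightarrow> f d = f c"
  unfolding constant_at_def by metis

section \<open>Relations as sums of functions constant at an inner entry\<close>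

context
  fixes P :: "'a::order set"
  assumes fin: "finite P"
begin

lemma mem_flag_cochains_iff:
  "f \<in> carrier (free_space (flags P i)) \<longleftrightarrow> (\<forall>c. c \<notin> flags P i \<longrightarrow> f c = 0)"
  by (rule mem_free_space_iff[OF finite_flags[OF fin]])

text \<open>The summation range is exactly the set of \<open>y\<close> for which
  \<open>c[p := y]\<close> is a flag, so the relator is the indicator function of the fibre of
  \<open>c\<close>.\<close>

lemma relator_apply:
  assumes c: "c \<in> flags P i" and p: "0 < p" "p < i"
  shows "(\<Sum>y | y \<in> P \<and> rank_in P y = p \<and> c ! (p - 1) < y \<and> y < c ! (p + 1).
              basis_vec (c[p := y]) d)
    = (if d \<in> flags P i \<and> d = c[p := d ! p] then 1 else 0)"
proof -
  have len: "p < length c"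
    using c p by (simp add: flags_iff)
  then have "basis_vec (c[p := y]) d = (if y = d ! p then basis_vec (c[p := d ! p]) d else 0)" for y
    by (auto simp: basis_vec_def)
  then have "(\<Sum>y | c[p := y] \<in> flags P i. basis_vec (c[p := y]) d)
    = (\<Sum>y | c[p := y] \<in> flags P i. if y = d ! p then basis_vec (c[p := d ! p]) d else 0)"
    by simp
  also have "\<dots> = (if c[p := d ! p] \<in> flags P i then basis_vec (c[p := d ! p]) d else 0)"
    using fin by (subst sum.delta) (auto simp: flag_upd_iff[OF c p])
  also have "\<dots> = (if d \<in> flags P i \<and> d = c[p := d ! p] then 1 else 0)"
    by (auto simp: basis_vec_def)
  finally show ?thesis
    unfolding flag_upd_iff[OF c p] .
qed

lemma constant_at_relator:
  assumes "g \<in> flag_relators P i"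
  obtains p where "0 < p" "p < i" "constant_at P i p g"
proof -
  from assms obtain c p where c: "c \<in> flags P i" "0 < p" "p < i"
    and "g = (\<lambda>d. \<Sum>y | y \<in> P \<and> rank_in P y = p \<and> c ! (p - 1) < y \<and> y < c ! (p + 1).
              basis_vec (c[p := y]) d)"
    by (auto simp: flag_relators_def)
  moreover define A where "A d \<longleftrightarrow> d = c[p := d ! p]" for d
  ultimately have g: "g = (\<lambda>d. if d \<in> flags P i \<and> A d then 1 else 0)"
    by (simp only: relator_apply[OF c])
  have "A (d[p := y]) \<longleftrightarrow> A d" for d y
    unfolding A_def eq_upd_iff by (auto simp: nth_list_update)
  then have "constant_at P i p g"
    by (simp add: constant_at_def mem_flag_cochains_iff g)
  with c that show ?thesis
    by blast
qed

lemma flag_relators_subset: "flag_relators P i \<subseteq> carrier (free_space (flags P i))"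
  by (rule subsetI, erule constant_at_relator, simp add: constant_at_def)

lemma submodule_flag_relations:
  "submodule (flag_relations P i) rat_field (free_space (flags P i))"
  unfolding flag_relations_def by (rule submodule_span_in[OF flag_relators_subset])

text \<open>Averaging the relators over the classes of flags that agree off position \<open>p\<close>.\<close>

lemma constant_at_in_relations:
  assumes p: "0 < p" "p < i" and f: "constant_at P i p f"
  shows "f \<in> flag_relations P i"
proof -
  define r where "r c = (\<lambda>d. \<Sum>y | y \<in> P \<and> rank_in P y = p \<and> c ! (p - 1) < y \<and> y < c ! (p + 1).
              basis_vec (c[p := y]) d)" for c
  define C where "C c = {d \<in> flags P i. d = c[p := d ! p]}" for c
  \<comment> \<open>A fibre contributes the same relator once for each of its flags, hence the
    division by its size.\<close>
  define g where "g = (\<lambda>d. \<Sum>c\<in>flags P i. f c / of_nat (card (C c)) * r c d)"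
  have "r c \<in> flag_relations P i" if "c \<in> flags P i" for c
  proof -
    have "r c \<in> flag_relators P i"
      unfolding flag_relators_def r_def
      by (rule CollectI, rule exI[of _ c], rule exI[of _ p]) (simp add: that p)
    then show ?thesis
      unfolding flag_relations_def by (rule subsetD[OF span_in_superset])
  qed
  then have "g \<in> flag_relations P i"
    unfolding g_def
    by (intro submodule_free_sum[OF submodule_flag_relations]
        submodule_free_smult[OF submodule_flag_relations])
  moreover have "g = f"
  proof
    fix d
    have r: "r c d = (if d \<in> flags P i \<and> d \<in> C c then 1 else 0)" if "c \<in> flags P i" for c
      using relator_apply[OF that p, of d] by (simp add: r_def C_def)
    show "g d = f d"
    proof (cases "d \<in> flags P i")
      case False
      then show ?thesis
        using f by (simp add: g_def r constant_at_def mem_flag_cochains_iff)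
    next
      case True
      have C: "d \<in> C c \<longleftrightarrow> c \<in> C d" if "c \<in> flags P i" for c
        using that True unfolding C_def mem_Collect_eq eq_upd_iff by metis
      have "f c / of_nat (card (C c)) * r c d
          = (if c \<in> C d then f d / of_nat (card (C d)) else 0)" if c: "c \<in> flags P i" for c
      proof (cases "c \<in> C d")
        case cd: True
        have "x \<in> C c \<longleftrightarrow> x \<in> C d" for x
          using cd unfolding C_def mem_Collect_eq eq_upd_iff by metis
        then have "C c = C d"
          by blast
        moreover have "f c = f d"
          using constant_atD[OF f True c] cd by (simp add: C_def)
        ultimately show ?thesis
          using cd c True C[OF c] r[OF c] by simp
      qed (use C[OF c] r[OF c] in simp)
      then have "g d = (\<Sum>c\<in>flags P i. if c \<in> C d then f d / of_nat (card (C d)) else 0)"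
        by (simp add: g_def)
      also have "\<dots> = (\<Sum>c\<in>flags P i \<inter> C d. f d / of_nat (card (C d)))"
        by (simp only: sum.inter_restrict[OF finite_flags[OF fin]])
      also have "flags P i \<inter> C d = C d"
        by (auto simp: C_def)
      also have "(\<Sum>c\<in>C d. f d / of_nat (card (C d))) = f d"
      proof -
        have "d \<in> C d" "finite (C d)"
          using True finite_flags[OF fin] by (auto simp: C_def)
        then show ?thesis
          by (auto simp: card_eq_0_iff)
      qed
      finally show ?thesis .
    qed
  qed
  ultimately show ?thesis
    by simp
qed

text \<open>Every map that has to respect the relations is handled by this criterion: relators are
  constant at an inner entry, and the preimage of \<open>K\<close> is a subspace.\<close>

lemma flag_relations_image_subset:
  assumes h: "linear_map (free_space (flags P i)) (free_space S) h"
    and K: "submodule K rat_field (free_space S)"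
    and const: "\<And>p f. 0 < p \<Longrightarrow> p < i \<Longrightarrow> constant_at P i p f \<Longrightarrow> h f \<in> K"
  shows "h ` flag_relations P i \<subseteq> K"
proof -
  have "flag_relators P i \<subseteq> {f \<in> carrier (free_space (flags P i)). h f \<in> K}"
  proof
    fix g assume g: "g \<in> flag_relators P i"
    then obtain p where "0 < p" "p < i" "constant_at P i p g"
      by (rule constant_at_relator)
    with const show "g \<in> {f \<in> carrier (free_space (flags P i)). h f \<in> K}"
      by (simp add: constant_at_def)
  qed
  from span_in_least[OF submodule_vimage[OF h K] this] show ?thesis
    by (auto simp: flag_relations_def)
qed

text \<open>A flag of degree at most 1 has no inner entry. For the augmentation this means that a
  class in degree 0 vanishes only if its representative does.\<close>

lemma flag_relations_trivial:
  assumes "i \<le> 1"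
  shows "flag_relations P i = {\<lambda>_. 0}"
proof -
  have "submodule {\<lambda>_. 0} rat_field (free_space (flags P i))"
    by (rule submodule_freeI) (auto simp: mem_flag_cochains_iff)
  moreover have "flag_relators P i = {}"
    using assms by (auto simp: flag_relators_def)
  ultimately have "flag_relations P i \<subseteq> {\<lambda>_. 0}"
    unfolding flag_relations_def by (intro span_in_least) auto
  then show ?thesis
    using submodule_free_zero[OF submodule_flag_relations[of i]] by blast
qed

text \<open>The body repeats the map inside \<open>flag_differential\<close> literally, so that the
  definition can be folded there.\<close>

definition flag_delta :: "nat \<Rightarrow> ('a list \<Rightarrow> rat) \<Rightarrow> ('a list \<Rightarrow> rat)" where
  "flag_delta i = linear_ext (flags P i)
          (\<lambda>c d. (-1) ^ i *
             (\<Sum>y | y \<in> P \<and> rank_in P y = Suc i \<and> last c < y. basis_vec (c @ [y]) d))"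

lemma extensions_apply:
  assumes "c \<in> flags P i"
  shows "(\<Sum>y | y \<in> P \<and> rank_in P y = Suc i \<and> last c < y. basis_vec (c @ [y]) d)
    = (if d \<in> flags P (Suc i) \<and> butlast d = c then 1 else 0)"
proof -
  let ?Y = "{y. y \<in> P \<and> rank_in P y = Suc i \<and> last c < y}"
  have "basis_vec (c @ [y]) d = (if y = last d then basis_vec (c @ [last d]) d else 0)" for y
    by (auto simp: basis_vec_def)
  then have "(\<Sum>y\<in>?Y. basis_vec (c @ [y]) d)
      = (\<Sum>y\<in>?Y. if y = last d then basis_vec (c @ [last d]) d else 0)"
    by simp
  also have "\<dots> = (if last d \<in> ?Y then basis_vec (c @ [last d]) d else 0)"
    using fin by (subst sum.delta) auto
  also have "\<dots> = (if c @ [last d] \<in> flags P (Suc i) then basis_vec (c @ [last d]) d else 0)"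
    using assms by (simp add: snoc_in_flags_iff)
  also have "\<dots> = (if d \<in> flags P (Suc i) \<and> butlast d = c then 1 else 0)"
    by (cases d rule: rev_cases) (auto simp: basis_vec_def dest: length_flag)
  finally show ?thesis .
qed

text \<open>A flag arises by extension from its truncation alone, so only one summand survives.
  Later computations with \<delta> use this pointwise form.\<close>

lemma flag_delta_apply:
  "flag_delta i f d = (if d \<in> flags P (Suc i) then (-1) ^ i * f (butlast d) else 0)"
proof -
  have "flag_delta i f d = (\<Sum>c\<in>flags P i. if c = butlast d then
          (if d \<in> flags P (Suc i) then (-1) ^ i * f (butlast d) else 0) else 0)"
    unfolding flag_delta_def linear_ext_def by (rule sum.cong) (auto simp: extensions_apply)
  also have "\<dots> = (if d \<in> flags P (Suc i) then (-1) ^ i * f (butlast d) else 0)"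
    by (subst sum.delta) (auto simp: finite_flags[OF fin] butlast_flag)
  finally show ?thesis .
qed

lemma linear_map_flag_delta:
  "linear_map (free_space (flags P i)) (free_space (flags P (Suc i))) (flag_delta i)"
  unfolding flag_delta_def
  by (rule linear_map_linear_ext) (auto simp: finite_flags[OF fin] extensions_apply)

text \<open>Removing the top commutes with changing an inner entry, so constancy at \<open>p\<close>
  survives.\<close>

lemma flag_delta_relations: "flag_delta i ` flag_relations P i \<subseteq> flag_relations P (Suc i)"
proof (rule flag_relations_image_subset[OF linear_map_flag_delta submodule_flag_relations])
  fix p f assume p: "0 < p" "p < i" and f: "constant_at P i p f"
  have "constant_at P (Suc i) p (flag_delta i f)"
    unfolding constant_at_def
  proof (intro conjI allI impI)
    show "flag_delta i f \<in> carrier (free_space (flags P (Suc i)))"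
      by (simp add: mem_flag_cochains_iff flag_delta_apply)
    fix d y assume d: "d \<in> flags P (Suc i)" "d[p := y] \<in> flags P (Suc i)"
    then have "butlast (d[p := y]) = (butlast d)[p := y]"
      using p by (simp add: butlast_list_update length_flag)
    moreover have "butlast d \<in> flags P i" "butlast (d[p := y]) \<in> flags P i"
      using d by (simp_all only: butlast_flag)
    ultimately show "flag_delta i f (d[p := y]) = flag_delta i f d"
      using d f by (simp add: flag_delta_apply constant_at_def)
  qed
  then show "flag_delta i f \<in> flag_relations P (Suc i)"
    using p by (intro constant_at_in_relations[where p = p]) simp_all
qed

text \<open>Two truncations forget the entries \<open>i + 1\<close> and \<open>i + 2\<close>. The
  first of them is inner in degree \<open>i + 2\<close>, so the composite is constant there: it is
  zero modulo relations, though not as a function.\<close>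

lemma flag_delta_delta_in_relations:
  "flag_delta (Suc i) (flag_delta i f) \<in> flag_relations P (Suc (Suc i))"
proof -
  have "constant_at P (Suc (Suc i)) (Suc i) (flag_delta (Suc i) (flag_delta i f))"
    unfolding constant_at_def
  proof (intro conjI allI impI)
    show "flag_delta (Suc i) (flag_delta i f) \<in> carrier (free_space (flags P (Suc (Suc i))))"
      by (simp add: mem_flag_cochains_iff flag_delta_apply)
    fix d y assume d: "d \<in> flags P (Suc (Suc i))" "d[Suc i := y] \<in> flags P (Suc (Suc i))"
    then have "butlast (d[Suc i := y]) = (butlast d)[Suc i := y]"
      by (simp add: butlast_list_update length_flag)
    moreover have "butlast d \<in> flags P (Suc i)" "butlast (d[Suc i := y]) \<in> flags P (Suc i)"
      using d by (simp_all only: butlast_flag)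
    moreover have "butlast ((butlast d)[Suc i := y]) = butlast (butlast d)"
      using d by (simp add: butlast_list_update length_flag)
    ultimately show "flag_delta (Suc i) (flag_delta i f) (d[Suc i := y])
      = flag_delta (Suc i) (flag_delta i f) d"
      using d by (simp only: flag_delta_apply if_True)
  qed
  then show ?thesis
    by (intro constant_at_in_relations[where p = "Suc i"]) simp_all
qed

end

section \<open>Rank in semimodular lattices\<close>

text \<open>The power of exponent 0 is equality on the whole type, so \<open>y \<in> P\<close> is
  available only after at least one step.\<close>

lemma covering_chain_le:
  assumes "(covers_in P ^^ k) x y"
  shows "x \<le> y \<and> (0 < k \<longrightarrow> x < y \<and> y \<in> P)"
  using assms
proof (induction k arbitrary: y)
  case (Suc k)
  from Suc.prems obtain z where "(covers_in P ^^ k) x z" "covers_in P z y"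
    by (rule relpowp_Suc_E)
  with Suc.IH[OF this(1)] have "x \<le> z" "z < y" "y \<in> P"
    by (simp_all add: covers_in_def)
  from this(1,2) have "x < y"
    by (rule order.strict_trans1)
  with \<open>y \<in> P\<close> show ?case
    by simp
qed auto

section \<open>Rank by longest chains, and saturated chains\<close>

context
  fixes P :: "'a::order set"
  assumes fin: "finite P"
begin

lemma card_chain_le_rank:
  assumes "C \<subseteq> {y \<in> P. y < x}" "Complete_Partial_Order.chain (\<le>) C"
  shows "card C \<le> rank_in P x"
proof -
  have "finite (card ` {C. C \<subseteq> {y \<in> P. y < x} \<and> Complete_Partial_Order.chain (\<le>) C})"
    by (rule finite_imageI, rule rev_finite_subset[of "Pow P"]) (use fin in auto)
  then show ?thesis
    unfolding rank_in_def using assms by (intro Max_ge) auto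
qed

lemma rank_chainE:
  obtains C where "C \<subseteq> {y \<in> P. y < x}" "Complete_Partial_Order.chain (\<le>) C" "card C = rank_in P x"
proof -
  let ?A = "{C. C \<subseteq> {y \<in> P. y < x} \<and> Complete_Partial_Order.chain (\<le>) C}"
  have "finite (card ` ?A)"
    by (rule finite_imageI, rule rev_finite_subset[of "Pow P"]) (use fin in auto)
  moreover have "{} \<in> ?A"
    by (simp add: chain_empty)
  ultimately have "rank_in P x \<in> card ` ?A"
    unfolding rank_in_def by (intro Max_in) blast+
  then obtain C where "C \<in> ?A" "rank_in P x = card C"
    by blast
  then show ?thesis
    by (intro that[of C]) auto
qed

lemma rank_strict_mono:
  assumes "u \<in> P" "u < w"
  shows "rank_in P u < rank_in P w"
proof -
  obtain C where C: "C \<subseteq> {y \<in> P. y < u}" "Complete_Partial_Order.chain (\<le>) C" "card C = rank_in P u"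
    by (rule rank_chainE)
  have "card (insert u C) \<le> rank_in P w"
  proof (rule card_chain_le_rank)
    show "insert u C \<subseteq> {y \<in> P. y < w}"
      using C(1) assms by (auto intro: order.strict_trans)
    show "Complete_Partial_Order.chain (\<le>) (insert u C)"
      using C(1,2) by (auto simp: chain_def intro: less_imp_le)
  qed
  moreover have "finite C" "u \<notin> C"
    using C(1) fin by (auto intro: finite_subset)
  ultimately show ?thesis
    using C(3) by simp
qed

text \<open>Take the maximum \<open>v\<close> of a longest chain below \<open>w\<close>. The rest of
  the chain lies below \<open>v\<close>, so the rank of \<open>v\<close> is at least that of
  \<open>w\<close> minus one.\<close>

lemma rank_predE:
  assumes "0 < rank_in P w"
  obtains v where "v \<in> P" "v < w" "rank_in P w = Suc (rank_in P v)"
proof -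
  obtain C where C: "C \<subseteq> {y \<in> P. y < w}" "Complete_Partial_Order.chain (\<le>) C" "card C = rank_in P w"
    by (rule rank_chainE)
  with assms have "finite C" "C \<noteq> {}"
    by (auto intro: card_ge_0_finite)
  then obtain v where v: "v \<in> C" "\<forall>y\<in>C. v \<le> y \<longrightarrow> v = y"
    using finite_has_maximal[of C] by blast
  have "card (C - {v}) \<le> rank_in P v"
  proof (rule card_chain_le_rank)
    show "C - {v} \<subseteq> {y \<in> P. y < v}"
      using v C(1,2) by (auto simp: chain_def less_le)
    show "Complete_Partial_Order.chain (\<le>) (C - {v})"
      using C(2) by (rule chain_subset) blast
  qed
  moreover have vw: "v \<in> P" "v < w"
    using v(1) C(1) by auto
  ultimately show ?thesis
    using that[OF vw] rank_strict_mono[OF vw] C(3) v(1) \<open>finite C\<close> by simp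
qed

lemma covering_chain_exists:
  assumes "x \<in> P" "y \<in> P" "x \<le> y"
  shows "\<exists>n. (covers_in P ^^ n) x y"
  using assms
proof (induction "card {z \<in> P. x < z \<and> z \<le> y}" arbitrary: x rule: less_induct)
  case less
  show ?case
  proof (cases "x = y")
    case True
    then show ?thesis
      by (intro exI[of _ 0]) simp
  next
    case False
    let ?A = "{z \<in> P. x < z \<and> z \<le> y}"
    have "finite ?A" "y \<in> ?A"
      using fin less.prems False by auto
    \<comment> \<open>A minimal element of the interval above \<open>x\<close> covers
      \<open>x\<close>, and the interval left above it is smaller.\<close>
    then obtain x' where x': "x' \<in> ?A" "\<forall>z\<in>?A. z \<le> x' \<longrightarrow> x' = z"
      using finite_has_minimal[of ?A] by blast
    then have "covers_in P x x'"
      using less.prems unfolding covers_in_def by (auto simp: less_le dest: order.trans)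
    moreover have "{z \<in> P. x' < z \<and> z \<le> y} \<subset> ?A"
      using x'(1) by auto
    then have "card {z \<in> P. x' < z \<and> z \<le> y} < card ?A"
      using \<open>finite ?A\<close> by (rule psubset_card_mono[rotated])
    then have "\<exists>n. (covers_in P ^^ n) x' y"
      using x'(1) less.prems by (intro less.hyps) auto
    ultimately show ?thesis
      using relpowp_Suc_I2[of "covers_in P" x x'] by blast
  qed
qed

lemma isLub_pair_iff:
  "isLub P {x, y} j \<longleftrightarrow> j \<in> P \<and> x \<le> j \<and> y \<le> j \<and> (\<forall>z\<in>P. x \<le> z \<longrightarrow> y \<le> z \<longrightarrow> j \<le> z)"
  by (auto simp: isLub_def leastP_def isUb_def setle_def setge_def)

lemma isGlb_pair_iff:
  "isGlb P {x, y} m \<longleftrightarrow> m \<in> P \<and> m \<le> x \<and> m \<le> y \<and> (\<forall>z\<in>P. z \<le> x \<longrightarrow> z \<le> y \<longrightarrow> z \<le> m)"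
  by (auto simp: isGlb_def greatestP_def isLb_def setle_def setge_def)

end

section \<open>Gradedness from semimodularity\<close>

context
  fixes P :: "'a::order set"
  assumes lat: "finite_lattice_on P" and semi: "semimodular_on P"
begin

lemma finite_of_lattice: "finite P"
  using lat by (simp add: finite_lattice_on_def)

lemma lub_exists: "x \<in> P \<Longrightarrow> y \<in> P \<Longrightarrow> \<exists>j. isLub P {x, y} j"
  using lat by (simp add: finite_lattice_on_def)

lemma glb_exists: "x \<in> P \<Longrightarrow> y \<in> P \<Longrightarrow> \<exists>m. isGlb P {x, y} m"
  using lat by (simp add: finite_lattice_on_def)

lemma covers_join:
  "x \<in> P \<Longrightarrow> y \<in> P \<Longrightarrow> isGlb P {x, y} m \<Longrightarrow> isLub P {x, y} j \<Longrightarrow> covers_in P m x \<Longrightarrow> covers_in P y j"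
  using semi unfolding semimodular_on_def by blast

text \<open>The Jordan-Dedekind chain condition.\<close>

lemma covering_chain_length_unique:
  assumes "(covers_in P ^^ n) x y" "(covers_in P ^^ m) x y"
  shows "m = n"
  using assms
proof (induction n arbitrary: m x)
  case 0
  then show ?case
    using covering_chain_le[of m P x y] by (cases m) auto
next
  case (Suc n)
  note fin = finite_of_lattice
  obtain x1 where x1: "covers_in P x x1" "(covers_in P ^^ n) x1 y"
    using Suc.prems(1) by (metis relpowp_Suc_D2)
  have "x < y" "y \<in> P"
    using covering_chain_le[OF Suc.prems(1)] by auto
  with Suc.prems(2) obtain m' where m': "m = Suc m'"
    by (cases m) auto
  then obtain y1 where y1: "covers_in P x y1" "(covers_in P ^^ m') y1 y"
    using Suc.prems(2) by (metis relpowp_Suc_D2)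
  have "m' = n"
  proof (cases "x1 = y1")
    case True
    with Suc.IH[OF x1(2)] y1(2) show ?thesis
      by simp
  next
    case False
    have P: "x1 \<in> P" "y1 \<in> P" "x \<in> P"
      using x1(1) y1(1) by (auto simp: covers_in_def)
    obtain g j where g: "isGlb P {x1, y1} g" and j: "isLub P {x1, y1} j"
      using glb_exists lub_exists P by blast
    \<comment> \<open>Two different elements covering \<open>x\<close> meet in \<open>x\<close>, so
      by semimodularity their join covers both.\<close>
    have "g = x"
    proof (rule ccontr)
      assume "g \<noteq> x"
      with g x1(1) y1(1) have "g \<in> P" "x < g" "g \<le> x1" "g \<le> y1"
        by (auto simp: isGlb_pair_iff[OF fin] covers_in_def less_le)
      with x1(1) y1(1) have "g = x1" "g = y1"
        by (auto simp: covers_in_def less_le)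
      with False show False
        by simp
    qed
    then have cov: "covers_in P y1 j" "covers_in P x1 j"
      using covers_join[OF P(1,2) g j] covers_join[OF P(2,1)] g j x1(1) y1(1)
      by (auto simp: insert_commute)
    have "j \<le> y"
      using j covering_chain_le[OF x1(2)] covering_chain_le[OF y1(2)] \<open>y \<in> P\<close> by (auto simp: isLub_pair_iff[OF fin])
    then obtain k where k: "(covers_in P ^^ k) j y"
      using covering_chain_exists[OF fin] cov \<open>y \<in> P\<close> unfolding covers_in_def by blast
    \<comment> \<open>The induction hypothesis at \<open>x1\<close> fixes the length of the route
      through \<open>j\<close>. The route from \<open>y1\<close> through \<open>j\<close> is equally
      long, which makes the hypothesis applicable at \<open>y1\<close>.\<close>
    have "Suc k = n"
      by (rule Suc.IH[OF x1(2) relpowp_Suc_I2[OF cov(2) k]])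
    then show ?thesis
      using Suc.IH[OF _ y1(2)] relpowp_Suc_I2[OF cov(1) k] by blast
  qed
  with m' show ?case
    by simp
qed

text \<open>Descending by \<open>rank_predE\<close> gives a saturated chain from the bottom to each
  element whose length is the rank. The chain to \<open>u\<close> extended by \<open>w\<close> and
  the chain to \<open>w\<close> are both saturated, hence equally long.\<close>

lemma rank_covers:
  assumes b: "b \<in> P" "\<And>y. y \<in> P \<Longrightarrow> b \<le> y" and uw: "covers_in P u w"
  shows "rank_in P w = Suc (rank_in P u)"
proof -
  note fin = finite_of_lattice
  have chain: "(covers_in P ^^ rank_in P v) b v" if "v \<in> P" for v
    using that
  proof (induction "rank_in P v" arbitrary: v)
    case 0
    from "0.hyps" have r: "rank_in P v = 0"
      by (rule sym)
    then have "\<not> b < v"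
      using rank_strict_mono[OF fin b(1), of v] by auto
    with b(2)[OF "0.prems"] have "v = b"
      by (simp add: order.order_iff_strict)
    then show ?case
      by (simp add: r[unfolded \<open>v = b\<close>])
  next
    case (Suc k)
    have "0 < rank_in P v"
      using Suc.hyps(2) by simp
    then obtain u where u: "u \<in> P" "u < v" "rank_in P v = Suc (rank_in P u)"
      by (rule rank_predE[OF fin])
    then have "covers_in P u v"
      using Suc.prems rank_strict_mono[OF fin, of u] rank_strict_mono[OF fin, of _ v]
      unfolding covers_in_def by fastforce
    moreover have "(covers_in P ^^ rank_in P u) b u"
      using Suc.hyps u by simp
    ultimately show ?case
      using relpowp_Suc_I u(3) by simp
  qed
  have "u \<in> P" "w \<in> P"
    using uw by (auto simp: covers_in_def)
  with chain covering_chain_length_unique[OF relpowp_Suc_I[OF chain[of u] uw]] show ?thesis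
    by blast
qed

end

section \<open>The contracting homotopy\<close>

lemma flag_nth_le_last:
  assumes "z \<in> flags P i" "j \<le> i"
  shows "z ! j \<le> last z"
  using assms sorted_wrt_nth_less[of "(<)" z j i]
  by (cases "j = i") (auto simp: last_flag flags_def intro: less_imp_le)

lemma last_flag_upd:
  assumes "z \<in> flags P i" "p < i"
  shows "last (z[p := y]) = last z"
proof -
  have "z \<noteq> []" "p \<noteq> length z - 1"
    using length_flag[OF assms(1)] assms(2) by auto
  then show ?thesis
    by (simp add: last_list_update)
qed

text \<open>The simplices of the prism operator of simplicial homotopy, with the identity at one end
  and \<open>J\<close> at the other. Entry \<open>j > k\<close> is the image of entry
  \<open>j - 1\<close>, so the list grows by one.\<close>

definition prism :: "('a \<Rightarrow> 'a) \<Rightarrow> nat \<Rightarrow> 'a list \<Rightarrow> 'a list" where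
  "prism J k z = map (\<lambda>j. if j \<le> k then z ! j else J (z ! (j - 1))) [0..<Suc (length z)]"

lemma length_prism [simp]: "length (prism J k z) = Suc (length z)"
  by (simp add: prism_def)

lemma nth_prism:
  "j \<le> length z \<Longrightarrow> prism J k z ! j = (if j \<le> k then z ! j else J (z ! (j - 1)))"
  unfolding prism_def by (subst nth_map) (auto simp del: upt_Suc)

text \<open>This face produces the identity in the homotopy formula; those of
  \<open>butlast_prism\<close> produce the terms that cancel.\<close>

lemma butlast_prism_last:
  "length z = Suc k \<Longrightarrow> butlast (prism J k z) = z"
  by (rule nth_equalityI) (auto simp: nth_butlast nth_prism)

lemma butlast_prism:
  "Suc k < length z \<Longrightarrow> butlast (prism J k z) = prism J k (butlast z)"
  by (rule nth_equalityI) (auto simp: nth_butlast nth_prism)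

text \<open>Here \<open>J u\<close> plays the role of \<open>u \<or> a\<close> for an atom \<open>a\<close>; of the lattice structure,
  only this enters the homotopy.\<close>

definition atom_join :: "'a::order set \<Rightarrow> 'a \<Rightarrow> ('a \<Rightarrow> 'a) \<Rightarrow> bool" where
  "atom_join P a J \<longleftrightarrow>
    (\<forall>u\<in>P. \<not> a \<le> u \<longrightarrow> J u \<in> P \<and> u < J u \<and> a \<le> J u \<and> rank_in P (J u) = Suc (rank_in P u)) \<and>
    (\<forall>u\<in>P. \<forall>w\<in>P. u < w \<longrightarrow> \<not> a \<le> w \<longrightarrow> J u < J w) \<and>
    (\<forall>u\<in>P. \<forall>w\<in>P. u < w \<longrightarrow> \<not> a \<le> u \<longrightarrow> a \<le> w \<longrightarrow>
      rank_in P w = Suc (rank_in P u) \<longrightarrow> J u = w) \<and>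
    (\<forall>u\<in>P. rank_in P u = 0 \<longrightarrow> \<not> a \<le> u)"

section \<open>The homotopy attached to an atom\<close>

context
  fixes P :: "'a::order set" and a :: 'a and J :: "'a \<Rightarrow> 'a"
  assumes fin: "finite P" and atom_join: "atom_join P a J"
begin

lemma join:
  "u \<in> P \<Longrightarrow> \<not> a \<le> u \<Longrightarrow> J u \<in> P \<and> u < J u \<and> a \<le> J u \<and> rank_in P (J u) = Suc (rank_in P u)"
  using atom_join by (simp add: atom_join_def)

lemma join_mono: "u \<in> P \<Longrightarrow> w \<in> P \<Longrightarrow> u < w \<Longrightarrow> \<not> a \<le> w \<Longrightarrow> J u < J w"
  using atom_join by (simp add: atom_join_def)

lemma join_eq:
  "u \<in> P \<Longrightarrow> w \<in> P \<Longrightarrow> u < w \<Longrightarrow> \<not> a \<le> u \<Longrightarrow> a \<le> w \<Longrightarrow>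
    rank_in P w = Suc (rank_in P u) \<Longrightarrow> J u = w"
  using atom_join by (simp add: atom_join_def)

lemma not_le_rank_zero: "u \<in> P \<Longrightarrow> rank_in P u = 0 \<Longrightarrow> \<not> a \<le> u"
  using atom_join by (simp add: atom_join_def)

lemma not_atom_le_nth:
  assumes "z \<in> flags P i" "\<not> a \<le> last z" "j \<le> i"
  shows "\<not> a \<le> z ! j"
  using assms flag_nth_le_last order_trans by blast

text \<open>Past index \<open>k\<close>, entries move up one place and their rank rises by one
  through the join, so position and rank still agree.\<close>

lemma prism_flag:
  assumes z: "z \<in> flags P i" "\<not> a \<le> last z" and k: "k \<le> i"
  shows "prism J k z \<in> flags P (Suc i)"
proof -
  have len: "length z = Suc i"
    using z(1) by (rule length_flag)
  have nle: "\<not> a \<le> z ! j" if "j \<le> i" for j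
    using not_atom_le_nth[OF z that] .
  have P: "z ! j \<in> P" "rank_in P (z ! j) = j" if "j \<le> i" for j
    using z(1) that by (simp_all add: flags_iff)
  have lt: "z ! j < z ! Suc j" if "j < i" for j
    using z(1) that by (simp add: flags_iff)
  have 1: "prism J k z ! j \<in> P \<and> rank_in P (prism J k z ! j) = j" if "j \<le> Suc i" for j
    using that k P[of j] P[of "j - 1"] join[OF P(1) nle, of "j - 1"] by (simp add: nth_prism len)
  have 2: "prism J k z ! j < prism J k z ! Suc j" if "j < Suc i" for j
  proof -
    consider "j < k" | "j = k" | "k < j"
      by linarith
    then show ?thesis
    proof cases
      case 1
      then show ?thesis
        using that k lt[of j] by (simp add: nth_prism len)
    next
      case 2
      then show ?thesis
        using that k join[OF P(1) nle, of j] by (simp add: nth_prism len)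
    next
      case 3
      then have "J (z ! (j - 1)) < J (z ! j)"
        using that lt[of "j - 1"] by (intro join_mono P nle) auto
      with 3 that show ?thesis
        by (simp add: nth_prism len)
    qed
  qed
  from 1 2 len show ?thesis
    unfolding flags_iff by auto
qed

text \<open>The index \<open>i\<close> is the degree of the target; the argument \<open>f\<close>
  has degree \<open>Suc i\<close>.\<close>

definition homotopy :: "nat \<Rightarrow> ('a list \<Rightarrow> rat) \<Rightarrow> ('a list \<Rightarrow> rat)" where
  "homotopy i f = (\<lambda>z. if z \<in> flags P i \<and> \<not> a \<le> last z
     then \<Sum>k\<le>i. (-1) ^ k * f (prism J k z) else 0)"

lemma linear_map_homotopy:
  "linear_map (free_space (flags P (Suc i))) (free_space (flags P i)) (homotopy i)"
  unfolding linear_map_def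
  by (auto simp: mem_flag_cochains_iff[OF fin] homotopy_def fun_eq_iff distrib_left sum.distrib
      sum_distrib_left intro!: sum.cong)

text \<open>In the alternating sum over \<open>k\<close>, the terms \<open>k = p - 1\<close> and \<open>k = p\<close> cancel because the two
  prism flags differ in position \<open>p\<close> only; the earlier terms do not depend on entry \<open>p - 1\<close>
  and the later ones do not depend on entry \<open>p\<close>.\<close>

lemma homotopy_constant_at:
  assumes p: "0 < p" "p < Suc i" and f: "constant_at P (Suc i) p f"
  shows "homotopy i f \<in> flag_relations P i"
proof -
  define part where "part K = (\<lambda>z. if z \<in> flags P i \<and> \<not> a \<le> last z
     then \<Sum>k\<in>K. (-1) ^ k * f (prism J k z) else 0)" for K
  have low: "part {..<p - 1} \<in> flag_relations P i"
  proof (cases "p = 1")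
    case True
    then show ?thesis
      using submodule_free_zero[OF submodule_flag_relations[OF fin]]
      by (simp add: part_def cong: if_cong)
  next
    case False
    \<comment> \<open>For \<open>k < p - 1\<close>, entry \<open>p - 1\<close> of \<open>z\<close>
      enters the prism flag only through its join, at position \<open>p\<close>, where
      \<open>f\<close> is constant.\<close>
    have "constant_at P i (p - 1) (part {..<p - 1})"
      unfolding constant_at_def
    proof (intro conjI allI impI)
      show "part {..<p - 1} \<in> carrier (free_space (flags P i))"
        by (simp add: mem_flag_cochains_iff[OF fin] part_def)
      fix z y assume z: "z \<in> flags P i" and zy: "z[p - 1 := y] \<in> flags P i"
      have last: "last (z[p - 1 := y]) = last z"
        using p by (intro last_flag_upd[OF z]) auto
      have "f (prism J k (z[p - 1 := y])) = f (prism J k z)" if "k < p - 1" "\<not> a \<le> last z" for k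
      proof (rule constant_atD[OF f])
        show "prism J k (z[p - 1 := y]) = (prism J k z)[p := prism J k (z[p - 1 := y]) ! p]"
          unfolding eq_upd_iff using that length_flag[OF z]
          by (auto simp: nth_prism nth_list_update)
      qed (use that p z zy last in \<open>auto intro: prism_flag\<close>)
      then show "part {..<p - 1} (z[p - 1 := y]) = part {..<p - 1} z"
        using z zy last by (simp add: part_def)
    qed
    then show ?thesis
      using p False by (intro constant_at_in_relations[OF fin, where p = "p - 1"]) simp_all
  qed
  have high: "part {p<..i} \<in> flag_relations P i"
  proof (cases "p = i")
    case True
    then show ?thesis
      using submodule_free_zero[OF submodule_flag_relations[OF fin]]
      by (simp add: part_def cong: if_cong)
  next
    case False
    \<comment> \<open>For \<open>k > p\<close>, entry \<open>p\<close> of \<open>z\<close> enters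
      the prism flag only as itself, at position \<open>p\<close>.\<close>
    have "constant_at P i p (part {p<..i})"
      unfolding constant_at_def
    proof (intro conjI allI impI)
      show "part {p<..i} \<in> carrier (free_space (flags P i))"
        by (simp add: mem_flag_cochains_iff[OF fin] part_def)
      fix z y assume z: "z \<in> flags P i" and zy: "z[p := y] \<in> flags P i"
      have last: "last (z[p := y]) = last z"
        using p False by (intro last_flag_upd[OF z]) auto
      have "f (prism J k (z[p := y])) = f (prism J k z)" if "p < k" "k \<le> i" "\<not> a \<le> last z" for k
      proof (rule constant_atD[OF f])
        show "prism J k (z[p := y]) = (prism J k z)[p := prism J k (z[p := y]) ! p]"
          unfolding eq_upd_iff using that length_flag[OF z]
          by (auto simp: nth_prism nth_list_update)
      qed (use that p z zy last in \<open>auto intro: prism_flag\<close>)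
      then show "part {p<..i} (z[p := y]) = part {p<..i} z"
        using z zy last by (simp add: part_def)
    qed
    then show ?thesis
      using p False by (intro constant_at_in_relations[OF fin, where p = p]) simp_all
  qed
  have "homotopy i f = (\<lambda>z. part {..<p - 1} z + part {p<..i} z)"
  proof
    fix z
    show "homotopy i f z = part {..<p - 1} z + part {p<..i} z"
    proof (cases "z \<in> flags P i \<and> \<not> a \<le> last z")
      case True
      have "f (prism J p z) = f (prism J (p - 1) z)"
      proof (rule constant_atD[OF f])
        show "prism J p z = (prism J (p - 1) z)[p := prism J p z ! p]"
          unfolding eq_upd_iff using True p length_flag[of z P i] by (auto simp: nth_prism)
      qed (use True p in \<open>auto intro: prism_flag\<close>)
      moreover have "(-1 :: rat) ^ p = - ((-1) ^ (p - 1))"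
        using p(1) by (cases p) auto
      moreover have "{..i} = {..<p - 1} \<union> {p - 1, p} \<union> {p<..i}"
        using p by auto
      moreover have "(\<Sum>k\<in>{..<p - 1} \<union> {p - 1, p} \<union> {p<..i}. (-1) ^ k * f (prism J k z))
        = (\<Sum>k<p - 1. (-1) ^ k * f (prism J k z)) + (\<Sum>k\<in>{p - 1, p}. (-1) ^ k * f (prism J k z))
          + (\<Sum>k\<in>{p<..i}. (-1) ^ k * f (prism J k z))"
        using p by (subst sum.union_disjoint, auto simp: sum.union_disjoint)+
      ultimately show ?thesis
        using True p by (simp add: homotopy_def part_def)
    qed (auto simp: homotopy_def part_def)
  qed
  with submodule_free_add[OF submodule_flag_relations[OF fin] low high] show ?thesis
    by simp
qed

lemma homotopy_relations: "homotopy i ` flag_relations P (Suc i) \<subseteq> flag_relations P i"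
  by (rule flag_relations_image_subset[OF fin linear_map_homotopy submodule_flag_relations[OF fin]])
    (rule homotopy_constant_at)

text \<open>The summand \<open>U\<close> removed in the induction step replaces entry \<open>m + 1\<close> by the join of entry \<open>m\<close>
  with \<open>a\<close>, so it does not depend on entry \<open>m + 1\<close>.\<close>

lemma normal_form:
  assumes f: "f \<in> carrier (free_space (flags P i))" and "m < i"
  shows "\<exists>g\<in>carrier (free_space (flags P i)). (\<lambda>c. f c - g c) \<in> flag_relations P i \<and>
    (\<forall>z\<in>flags P i. a \<le> z ! m \<longrightarrow> g z = 0)"
  using \<open>m < i\<close>
proof (induction m)
  case 0
  have "\<not> a \<le> z ! 0" if "z \<in> flags P i" for z
    using that by (intro not_le_rank_zero) (auto simp: flags_iff)
  with f submodule_free_zero[OF submodule_flag_relations[OF fin]] show ?case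
    by (intro bexI[of _ f]) auto
next
  case (Suc m)
  note sub = submodule_flag_relations[OF fin, of i]
  from Suc obtain g where g: "g \<in> carrier (free_space (flags P i))"
    and fg: "(\<lambda>c. f c - g c) \<in> flag_relations P i"
    and g0: "\<And>z. z \<in> flags P i \<Longrightarrow> a \<le> z ! m \<Longrightarrow> g z = 0"
    by (metis Suc_lessD)
  \<comment> \<open>If \<open>a\<close> is not below entry \<open>m\<close>, the only flag in the
    fibre whose entry \<open>m + 1\<close> can be above \<open>a\<close> is the one with the join
    there. \<open>U\<close> spreads the value of \<open>g\<close> at that flag over the
    fibre.\<close>
  define U where "U = (\<lambda>z. if z \<in> flags P i \<and> \<not> a \<le> z ! m \<and> a \<le> z ! Suc (Suc m)
    then g (z[Suc m := J (z ! m)]) else 0)"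
  have "constant_at P i (Suc m) U"
    by (auto simp: constant_at_def mem_flag_cochains_iff[OF fin] U_def)
  then have U: "U \<in> flag_relations P i"
    using Suc.prems by (intro constant_at_in_relations[OF fin, where p = "Suc m"]) simp_all
  show ?case
  proof (intro bexI conjI ballI impI)
    show "(\<lambda>c. g c - U c) \<in> carrier (free_space (flags P i))"
      using g by (simp add: mem_flag_cochains_iff[OF fin] U_def)
    show "(\<lambda>c. f c - (g c - U c)) \<in> flag_relations P i"
      using submodule_free_add[OF sub fg U] by (simp add: algebra_simps)
    fix z assume z: "z \<in> flags P i" "a \<le> z ! Suc m"
    have P: "z ! m \<in> P" "z ! Suc m \<in> P" "rank_in P (z ! Suc m) = Suc m" "rank_in P (z ! m) = m"
      "z ! m < z ! Suc m" "z ! Suc m < z ! Suc (Suc m)"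
      using z(1) Suc.prems by (auto simp: flags_iff)
    show "g z - U z = 0"
    proof (cases "a \<le> z ! m")
      case True
      with g0 z(1) show ?thesis
        by (simp add: U_def)
    next
      case False
      with P z(2) have "J (z ! m) = z ! Suc m"
        by (intro join_eq) auto
      moreover have "a \<le> z ! Suc (Suc m)"
        using z(2) P(6) by simp
      ultimately show ?thesis
        using False z(1) by (simp add: U_def)
    qed
  qed
qed

text \<open>The cases follow the place where \<open>z\<close> gets above \<open>a\<close>: not at
  all, exactly at the top, or earlier. In the last case both summands are 0, and \<open>f0\<close>
  supplies the same value on the left.\<close>

lemma homotopy_identity:
  assumes f: "f \<in> carrier (free_space (flags P (Suc n)))"
    and f0: "\<And>z. z \<in> flags P (Suc n) \<Longrightarrow> a \<le> z ! n \<Longrightarrow> f z = 0"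
  shows "f z = flag_delta P n (homotopy n f) z + homotopy (Suc n) (flag_delta P (Suc n) f) z"
proof (cases "z \<in> flags P (Suc n)")
  case False
  with f show ?thesis
    by (simp add: flag_delta_apply[OF fin] homotopy_def mem_flag_cochains_iff[OF fin])
next
  case True
  let ?S = "\<Sum>k\<le>n. (-1) ^ k * f (prism J k (butlast z))"
  have len: "length z = Suc (Suc n)"
    using length_flag[OF True] .
  have bz: "butlast z \<in> flags P n"
    using True by (rule butlast_flag)
  have last: "last (butlast z) = z ! n"
    using last_flag[OF bz] len by (simp add: nth_butlast)
  have nth: "z ! n \<in> P" "last z \<in> P" "z ! n < last z" "rank_in P (last z) = Suc (rank_in P (z ! n))"
    using True last_flag[OF True] by (auto simp: flags_iff)
  have dh: "flag_delta P n (homotopy n f) z = (if a \<le> z ! n then 0 else (-1) ^ n * ?S)"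
    using True bz last by (simp add: flag_delta_apply[OF fin] homotopy_def)
  show ?thesis
  proof (cases "a \<le> last z")
    case False
    then have "\<not> a \<le> z ! n"
      using nth(3) by (meson less_imp_le order_trans)
    \<comment> \<open>The signs of \<delta> in degrees \<open>n\<close> and \<open>Suc n\<close> are
      opposite, so these terms cancel against \<delta> after \<open>h\<close>; the remaining index
      \<open>Suc n\<close> gives \<open>f z\<close>.\<close>
    have "(-1) ^ k * flag_delta P (Suc n) f (prism J k z)
        = - ((-1) ^ n * ((-1) ^ k * f (prism J k (butlast z))))" if "k \<le> n" for k
      using that prism_flag[OF True False, of k] len
      by (simp add: flag_delta_apply[OF fin] butlast_prism)
    then have "(\<Sum>k\<le>n. (-1) ^ k * flag_delta P (Suc n) f (prism J k z)) = - ((-1) ^ n * ?S)"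
      by (simp add: sum_distrib_left sum_negf)
    moreover have "(-1) ^ Suc n * flag_delta P (Suc n) f (prism J (Suc n) z) = f z"
      using prism_flag[OF True False, of "Suc n"] len
      by (simp add: flag_delta_apply[OF fin] butlast_prism_last)
    ultimately have "homotopy (Suc n) (flag_delta P (Suc n) f) z = f z - (-1) ^ n * ?S"
      using True False by (simp add: homotopy_def)
    with dh \<open>\<not> a \<le> z ! n\<close> show ?thesis
      by simp
  next
    case a: True
    then have hd: "homotopy (Suc n) (flag_delta P (Suc n) f) z = 0"
      by (simp add: homotopy_def)
    show ?thesis
    proof (cases "a \<le> z ! n")
      case True
      with hd dh f0 \<open>z \<in> flags P (Suc n)\<close> show ?thesis
        by simp
    next
      case False
      \<comment> \<open>The top of \<open>z\<close> is the join of entry \<open>n\<close> with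
        \<open>a\<close>, so \<open>z\<close> is itself a prism flag over its truncation.\<close>
      have z: "prism J n (butlast z) = z"
      proof (rule nth_equalityI)
        have "J (z ! n) = z ! Suc n"
          using join_eq[OF nth(1-3) False a nth(4)] last_flag[OF True] by simp
        moreover fix j assume "j < length (prism J n (butlast z))"
        ultimately show "prism J n (butlast z) ! j = z ! j"
          using len by (cases "j = Suc n") (auto simp: nth_prism nth_butlast)
      qed (simp add: len)
      \<comment> \<open>For smaller indices entry \<open>n\<close> of the prism flag is already a
        join, hence above \<open>a\<close>, where \<open>f\<close> vanishes.\<close>
      have "f (prism J k (butlast z)) = 0" if "k < n" for k
      proof (cases "prism J k (butlast z) \<in> flags P (Suc n)")
        case False
        with f show ?thesis
          by (simp add: mem_flag_cochains_iff[OF fin])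
      next
        case pf: True
        have "z ! (n - 1) \<in> P" "z ! (n - 1) < z ! n"
          using True that Suc_pred[of n] by (auto simp: flags_iff dest: spec[of _ "n - 1"])
        moreover have "\<not> a \<le> z ! (n - 1)"
          using False \<open>z ! (n - 1) < z ! n\<close> by (meson less_imp_le order_trans)
        moreover have "prism J k (butlast z) ! n = J (z ! (n - 1))"
          using that len by (simp add: nth_prism nth_butlast)
        ultimately show ?thesis
          using join f0[OF pf] by simp
      qed
      then have "?S = (-1) ^ n * f z"
        by (simp add: lessThan_Suc_atMost[symmetric] z)
      with dh hd False show ?thesis
        by simp
    qed
  qed
qed

text \<open>For the normal form \<open>g\<close> of \<open>f\<close>, the difference of
  \<open>g\<close> and \<delta> of \<open>homotopy n g\<close> is \<open>h\<close> applied to a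
  relation, hence a relation. The primitive of \<open>f\<close> is thus
  \<open>homotopy n g\<close>.\<close>

lemma flag_complex_exact:
  assumes f: "f \<in> carrier (free_space (flags P (Suc n)))"
    and df: "flag_delta P (Suc n) f \<in> flag_relations P (Suc (Suc n))"
  shows "\<exists>w\<in>carrier (free_space (flags P n)).
    (\<lambda>c. f c - flag_delta P n w c) \<in> flag_relations P (Suc n)"
proof -
  note sub = submodule_flag_relations[OF fin]
  obtain g where g: "g \<in> carrier (free_space (flags P (Suc n)))"
    and fg: "(\<lambda>c. f c - g c) \<in> flag_relations P (Suc n)"
    and g0: "\<And>z. z \<in> flags P (Suc n) \<Longrightarrow> a \<le> z ! n \<Longrightarrow> g z = 0"
    using normal_form[OF f, of n] by auto
  have "flag_delta P (Suc n) (\<lambda>c. f c - g c) \<in> flag_relations P (Suc (Suc n))"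
    using flag_delta_relations[OF fin] fg by blast
  from submodule_free_diff[OF sub df this]
  have "flag_delta P (Suc n) g \<in> flag_relations P (Suc (Suc n))"
    by (simp add: linear_map_diff[OF linear_map_flag_delta[OF fin] f g])
  then have "homotopy (Suc n) (flag_delta P (Suc n) g) \<in> flag_relations P (Suc n)"
    using homotopy_relations by blast
  note submodule_free_add[OF sub fg this]
  also have "(\<lambda>c. f c - g c + homotopy (Suc n) (flag_delta P (Suc n) g) c)
      = (\<lambda>c. f c - flag_delta P n (homotopy n g) c)"
  proof
    fix c
    from homotopy_identity[OF g g0, of c]
    show "f c - g c + homotopy (Suc n) (flag_delta P (Suc n) g) c
        = f c - flag_delta P n (homotopy n g) c"
      by linarith
  qed
  finally have "(\<lambda>c. f c - flag_delta P n (homotopy n g) c) \<in> flag_relations P (Suc n)" .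
  with linear_map_in[OF linear_map_homotopy g] show ?thesis
    by blast
qed

text \<open>In degree 0 the only entry is never above \<open>a\<close>, so \<open>h\<close> after
  \<delta> is already the identity and no normal form is called for.\<close>

lemma flag_delta_zero_injective:
  assumes f: "f \<in> carrier (free_space (flags P 0))"
    and df: "flag_delta P 0 f \<in> flag_relations P (Suc 0)"
  shows "f \<in> flag_relations P 0"
proof -
  have "homotopy 0 (flag_delta P 0 f) z = f z" for z
  proof (cases "z \<in> flags P 0")
    case True
    then have z: "length z = Suc 0" "\<not> a \<le> last z"
      using not_le_rank_zero[of "z ! 0"] True last_flag[OF True] by (simp_all add: flags_iff)
    with True show ?thesis
      using prism_flag[OF True z(2)]
      by (simp add: homotopy_def flag_delta_apply[OF fin] butlast_prism_last)
  next
    case False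
    with f show ?thesis
      by (simp add: homotopy_def mem_flag_cochains_iff[OF fin])
  qed
  then have "homotopy 0 (flag_delta P 0 f) = f"
    by (rule ext)
  with homotopy_relations df show ?thesis
    by (metis image_subset_iff)
qed

end

section \<open>The flag sheaves\<close>

context
  fixes L :: "'a::order set"
  assumes fin: "finite L"
begin

lemma finite_below: "finite (below L x)"
  using fin by (simp add: below_def)

lemma rank_below:
  assumes "y \<le> x"
  shows "rank_in (below L x) y = rank_in L y"
proof -
  have "{z \<in> below L x. z < y} = {z \<in> L. z < y}"
    using assms by (auto simp: below_def)
  then show ?thesis
    by (simp add: rank_in_def)
qed

text \<open>All stalks thus consist of classes of functions on one set of flags, cut off by the top.
  Restriction becomes truncation, and representatives at different elements can be compared
  directly.\<close>

lemma flags_below: "flags (below L x) i = {c \<in> flags L i. last c \<le> x}"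
proof (intro Set.set_eqI iffI)
  fix c assume c: "c \<in> flags (below L x) i"
  then have j: "c ! j \<in> L" "c ! j \<le> x" if "j \<le> i" for j
    using that by (simp_all add: flags_iff below_def)
  then show "c \<in> {c \<in> flags L i. last c \<le> x}"
    using c last_flag[OF c] by (simp add: flags_iff rank_below)
next
  fix c assume "c \<in> {c \<in> flags L i. last c \<le> x}"
  then have c: "c \<in> flags L i" "last c \<le> x"
    by auto
  have "c ! j \<le> x" if "j \<le> i" for j
    using flag_nth_le_last[OF c(1) that] c(2) by (rule order.trans)
  moreover from this have "c ! j \<in> below L x" if "j \<le> i" for j
    using c(1) that by (simp add: flags_iff below_def)
  ultimately show "c \<in> flags (below L x) i"
    using c(1) by (simp add: flags_iff rank_below)
qed

lemma mem_stalk_cochains_iff: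
  "f \<in> carrier (free_space (flags (below L x) i)) \<longleftrightarrow>
    (\<forall>c. \<not> (c \<in> flags L i \<and> last c \<le> x) \<longrightarrow> f c = 0)"
  by (subst mem_flag_cochains_iff[OF finite_below]) (auto simp: flags_below)

definition flag_restriction :: "nat \<Rightarrow> 'a \<Rightarrow> 'a \<Rightarrow> ('a list \<Rightarrow> rat) \<Rightarrow> ('a list \<Rightarrow> rat)" where
  "flag_restriction i x1 x0 = linear_ext (flags (below L x1) i)
     (\<lambda>c. if last c \<le> x0 then basis_vec c else (\<lambda>_. 0))"

lemma flag_restriction_apply:
  assumes f: "f \<in> carrier (free_space (flags (below L x1) i))"
  shows "flag_restriction i x1 x0 f = (\<lambda>d. if last d \<le> x0 then f d else 0)"
proof
  fix d
  have "flag_restriction i x1 x0 f d = (\<Sum>c\<in>flags (below L x1) i. if c = d then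
          (if last d \<le> x0 then f d else 0) else 0)"
    unfolding flag_restriction_def linear_ext_def by (rule sum.cong) (auto simp: basis_vec_def)
  also have "\<dots> = (if d \<in> flags (below L x1) i then if last d \<le> x0 then f d else 0 else 0)"
    by (rule sum.delta[OF finite_flags[OF finite_below]])
  also have "\<dots> = (if last d \<le> x0 then f d else 0)"
    using f by (simp add: mem_flag_cochains_iff[OF finite_below])
  finally show "flag_restriction i x1 x0 f d = (if last d \<le> x0 then f d else 0)" .
qed

lemma linear_map_flag_restriction:
  assumes "x0 \<le> x1"
  shows "linear_map (free_space (flags (below L x1) i)) (free_space (flags (below L x0) i))
    (flag_restriction i x1 x0)"
  unfolding flag_restriction_def using assms
  by (intro linear_map_linear_ext finite_flags finite_below) (auto simp: flags_below basis_vec_def)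

lemma flag_restriction_relations:
  assumes le: "x0 \<le> x1"
  shows "flag_restriction i x1 x0 ` flag_relations (below L x1) i \<subseteq> flag_relations (below L x0) i"
proof (rule flag_relations_image_subset[OF finite_below linear_map_flag_restriction[OF le]
      submodule_flag_relations[OF finite_below]])
  fix p f assume p: "0 < p" "p < i" and f: "constant_at (below L x1) i p f"
  have fc: "f \<in> carrier (free_space (flags (below L x1) i))"
    using f by (simp add: constant_at_def)
  have "constant_at (below L x0) i p (flag_restriction i x1 x0 f)"
    unfolding constant_at_def
  proof (intro conjI allI impI)
    show "flag_restriction i x1 x0 f \<in> carrier (free_space (flags (below L x0) i))"
      by (rule linear_map_in[OF linear_map_flag_restriction[OF le] fc])
    fix c y assume c: "c \<in> flags (below L x0) i" "c[p := y] \<in> flags (below L x0) i"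
    then have "c \<in> flags (below L x1) i" "c[p := y] \<in> flags (below L x1) i"
      using le by (auto simp: flags_below)
    with c f show "flag_restriction i x1 x0 f (c[p := y]) = flag_restriction i x1 x0 f c"
      by (simp add: flag_restriction_apply[OF fc] flags_below constant_at_def)
  qed
  then show "flag_restriction i x1 x0 f \<in> flag_relations (below L x0) i"
    by (rule constant_at_in_relations[OF finite_below p])
qed

text \<open>Changing an inner entry keeps the top, so extension by zero preserves constancy. This
  allows relations found at several elements below \<open>x\<close> to be added up at
  \<open>x\<close>.\<close>

lemma flag_relations_mono:
  assumes le: "x0 \<le> x1"
  shows "flag_relations (below L x0) i \<subseteq> flag_relations (below L x1) i"
proof -
  have "\<not> last c \<le> x0" if "\<not> last c \<le> x1" for c
    using that le by (meson order.trans)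
  then have "linear_map (free_space (flags (below L x0) i)) (free_space (flags (below L x1) i)) (\<lambda>f. f)"
    unfolding linear_map_def by (auto simp: mem_stalk_cochains_iff)
  then have "(\<lambda>f. f) ` flag_relations (below L x0) i \<subseteq> flag_relations (below L x1) i"
  proof (rule flag_relations_image_subset[OF finite_below _ submodule_flag_relations[OF finite_below]])
    fix p f assume p: "0 < p" "p < i" and f: "constant_at (below L x0) i p f"
    have "constant_at (below L x1) i p f"
      unfolding constant_at_def
    proof (intro conjI allI impI)
      show "f \<in> carrier (free_space (flags (below L x1) i))"
        using f by (auto simp: constant_at_def mem_stalk_cochains_iff dest: order.trans[OF _ le])
      fix c y assume c: "c \<in> flags (below L x1) i" "c[p := y] \<in> flags (below L x1) i"
      have "last (c[p := y]) = last c"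
        by (rule last_flag_upd[OF c(1) p(2)])
      show "f (c[p := y]) = f c"
      proof (cases "last c \<le> x0")
        case True
        with c f \<open>last (c[p := y]) = last c\<close> show ?thesis
          by (simp add: constant_at_def flags_below)
      next
        case False
        have "f d = 0" if "\<not> last d \<le> x0" for d
          using f that by (auto simp: constant_at_def mem_stalk_cochains_iff)
        with False \<open>last (c[p := y]) = last c\<close> show ?thesis
          by simp
      qed
    qed
    then show "f \<in> flag_relations (below L x1) i"
      by (rule constant_at_in_relations[OF finite_below p])
  qed
  then show ?thesis
    by simp
qed

section \<open>The flag sheaves and their differential on classes\<close>

abbreviation flag_class :: "nat \<Rightarrow> 'a \<Rightarrow> ('a list \<Rightarrow> rat) \<Rightarrow> ('a list \<Rightarrow> rat) set" where
  "flag_class i x f \<equiv>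
     flag_relations (below L x) i +>\<^bsub>free_space (flags (below L x) i)\<^esub> f"

lemma flag_sheaf_sel [simp]:
  "stalk (flag_sheaf L i) x = quotient_space (free_space (flags (below L x) i)) (flag_relations (below L x) i)"
  "res (flag_sheaf L i) = flag_projection L i"
  by (simp_all add: flag_sheaf_def flag_space_def)

lemmas submodule_stalk = submodule_flag_relations[OF finite_below]

lemma flag_projection_class:
  assumes "x0 \<le> x1" "f \<in> carrier (free_space (flags (below L x1) i))"
  shows "flag_projection L i x1 x0 (flag_class i x1 f) = flag_class i x0 (\<lambda>d. if last d \<le> x0 then f d else 0)"
  unfolding flag_projection_def flag_restriction_def[symmetric]
  using induced_map_coset[OF submodule_stalk submodule_stalk linear_map_flag_restriction
      flag_restriction_relations] assms flag_restriction_apply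
  by simp

lemma flag_sheaf_differential_class:
  assumes "f \<in> carrier (free_space (flags (below L x) i))"
  shows "flag_sheaf_differential L i x (flag_class i x f)
    = flag_class (Suc i) x (flag_delta (below L x) i f)"
  unfolding flag_sheaf_differential_def flag_differential_def flag_delta_def[OF finite_below, symmetric]
  by (rule induced_map_coset[OF submodule_stalk submodule_stalk linear_map_flag_delta[OF finite_below]
      flag_delta_relations[OF finite_below] assms])

lemma sheaf_on_flag_sheaf: "sheaf_on L (flag_sheaf L i)"
  unfolding sheaf_on_def flag_sheaf_sel
proof (intro conjI ballI impI)
  fix x
  show "Module.module rat_field
      (quotient_space (free_space (flags (below L x) i)) (flag_relations (below L x) i))"
    by (rule module_quotient[OF submodule_stalk])
next
  fix x y :: 'a assume "x \<le> y"
  then show "linear_map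
      (quotient_space (free_space (flags (below L y) i)) (flag_relations (below L y) i))
      (quotient_space (free_space (flags (below L x) i)) (flag_relations (below L x) i))
      (flag_projection L i y x)"
    unfolding flag_projection_def flag_restriction_def[symmetric]
    by (intro linear_map_induced submodule_stalk linear_map_flag_restriction flag_restriction_relations)
next
  fix x s
  assume "s \<in> carrier (quotient_space (free_space (flags (below L x) i)) (flag_relations (below L x) i))"
  then obtain f where f: "f \<in> carrier (free_space (flags (below L x) i))" "s = flag_class i x f"
    by (rule quotientE[OF submodule_stalk])
  moreover have "(\<lambda>d. if last d \<le> x then f d else 0) = f"
    using f(1) by (auto simp: mem_stalk_cochains_iff)
  ultimately show "flag_projection L i x x s = s"
    by (simp add: flag_projection_class)
next
  fix x y z s
  assume le: "x \<le> y" "y \<le> z"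
    and "s \<in> carrier (quotient_space (free_space (flags (below L z) i)) (flag_relations (below L z) i))"
  then obtain f where f: "f \<in> carrier (free_space (flags (below L z) i))" "s = flag_class i z f"
    by (auto elim: quotientE[OF submodule_stalk])
  moreover have "(\<lambda>d. if last d \<le> y then f d else 0) \<in> carrier (free_space (flags (below L y) i))"
    using f(1) le by (auto simp: mem_stalk_cochains_iff)
  moreover have "(\<lambda>d. if last d \<le> x then if last d \<le> y then f d else 0 else 0)
      = (\<lambda>d. if last d \<le> x then f d else 0)"
    by (intro ext) (auto dest: order.trans[OF _ le(1)])
  ultimately show "flag_projection L i y x (flag_projection L i z y s) = flag_projection L i z x s"
    using le by (simp add: flag_projection_class order.trans[OF le])
qed

text \<open>Truncating a flag lowers its top, so at flags below \<open>x\<close> the differential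
  reads \<open>f\<close> only at flags below \<open>x\<close>.\<close>

lemma flag_delta_restrict:
  assumes "x \<le> y"
  shows "flag_delta (below L x) i (\<lambda>d. if last d \<le> x then f d else 0)
    = (\<lambda>d. if last d \<le> x then flag_delta (below L y) i f d else 0)"
proof
  fix d
  have "last (butlast d) \<le> x" if "d \<in> flags L (Suc i)" "last d \<le> x"
    using that by (auto elim!: flag_SucE)
  then show "flag_delta (below L x) i (\<lambda>d. if last d \<le> x then f d else 0) d
    = (if last d \<le> x then flag_delta (below L y) i f d else 0)"
    using assms by (auto simp: flag_delta_apply[OF finite_below] flags_below)
qed

lemma sheaf_hom_flag_sheaf_differential:
  "sheaf_hom L (flag_sheaf L i) (flag_sheaf L (Suc i)) (flag_sheaf_differential L i)"
  unfolding sheaf_hom_def flag_sheaf_sel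
proof (intro conjI ballI impI)
  fix x
  show "linear_map
      (quotient_space (free_space (flags (below L x) i)) (flag_relations (below L x) i))
      (quotient_space (free_space (flags (below L x) (Suc i))) (flag_relations (below L x) (Suc i)))
      (flag_sheaf_differential L i x)"
    unfolding flag_sheaf_differential_def flag_differential_def
      flag_delta_def[OF finite_below, symmetric]
    by (intro linear_map_induced submodule_stalk linear_map_flag_delta flag_delta_relations finite_below)
next
  fix x y s
  assume le: "x \<le> y"
    and "s \<in> carrier (quotient_space (free_space (flags (below L y) i)) (flag_relations (below L y) i))"
  then obtain f where f: "f \<in> carrier (free_space (flags (below L y) i))" "s = flag_class i y f"
    by (auto elim: quotientE[OF submodule_stalk])
  moreover have "(\<lambda>d. if last d \<le> x then f d else 0) \<in> carrier (free_space (flags (below L x) i))"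
    using f(1) le by (auto simp: mem_stalk_cochains_iff)
  moreover have "flag_delta (below L y) i f \<in> carrier (free_space (flags (below L y) (Suc i)))"
    by (rule linear_map_in[OF linear_map_flag_delta[OF finite_below] f(1)])
  ultimately show "flag_sheaf_differential L i x (flag_projection L i y x s)
      = flag_projection L (Suc i) y x (flag_sheaf_differential L i y s)"
    using le by (simp add: flag_projection_class flag_sheaf_differential_class flag_delta_restrict)
qed

lemma sheaf_complex_flag_sheaf: "sheaf_complex L (flag_sheaf L) (flag_sheaf_differential L)"
  unfolding sheaf_complex_def
proof (intro conjI allI ballI)
  fix i x s assume "s \<in> carrier (stalk (flag_sheaf L i) x)"
  then obtain f where f: "f \<in> carrier (free_space (flags (below L x) i))" "s = flag_class i x f"
    by (auto elim: quotientE[OF submodule_stalk])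
  note d = linear_map_in[OF linear_map_flag_delta[OF finite_below]]
  have "flag_class (Suc (Suc i)) x (flag_delta (below L x) (Suc i) (flag_delta (below L x) i f))
      = flag_relations (below L x) (Suc (Suc i))"
    using coset_eq_self_iff[OF submodule_stalk d[OF d[OF f(1)]]]
      flag_delta_delta_in_relations[OF finite_below] by simp
  then show "flag_sheaf_differential L (Suc i) x (flag_sheaf_differential L i x s)
      = \<zero>\<^bsub>stalk (flag_sheaf L (Suc (Suc i))) x\<^esub>"
    by (simp add: f flag_sheaf_differential_class d zero_quotient[OF submodule_stalk])
qed (rule sheaf_on_flag_sheaf sheaf_hom_flag_sheaf_differential)+

text \<open>Representatives at the elements of rank \<open>i\<close> glue to one cochain on all flags, because a flag
  is seen by exactly one such element, namely its top.\<close>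

lemma flag_sheaf_section_cochain:
  assumes V: "order_ideal L V" and s: "s \<in> sections (flag_sheaf L i) V"
  obtains f where "\<And>c. c \<notin> flags L i \<Longrightarrow> f c = 0"
    "\<And>x. x \<in> V \<Longrightarrow> s x = flag_class i x (\<lambda>d. if last d \<le> x then f d else 0)"
proof -
  have VL: "V \<subseteq> L" and down: "\<And>x y. x \<in> V \<Longrightarrow> y \<in> L \<Longrightarrow> y \<le> x \<Longrightarrow> y \<in> V"
    using V by (auto simp: order_ideal_def)
  have "\<exists>f. f \<in> carrier (free_space (flags (below L x) i)) \<and> s x = flag_class i x f" if "x \<in> V" for x
  proof -
    have "s x \<in> carrier (stalk (flag_sheaf L i) x)"
      using s that by (auto simp: sections_def)
    then show ?thesis
      by (auto elim: quotientE[OF submodule_stalk])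
  qed
  then obtain e where e: "\<And>x. x \<in> V \<Longrightarrow> e x \<in> carrier (free_space (flags (below L x) i))"
    and se: "\<And>x. x \<in> V \<Longrightarrow> s x = flag_class i x (e x)"
    by metis
  define f where "f = (\<lambda>d. if d \<in> flags L i \<and> last d \<in> V then e (last d) d else 0)"
  show ?thesis
  proof (rule that[of f])
    fix x assume x: "x \<in> V"
    \<comment> \<open>The discrepancy between the representatives chosen at \<open>x\<close> and at
      \<open>y\<close>. Compatibility of the section makes it a relation for \<open>y\<close> in
      \<open>?Y\<close>.\<close>
    define k where "k y = (\<lambda>d. (if last d \<le> y then e x d else 0) - e y d)" for y
    let ?Y = "{y \<in> L. y \<le> x \<and> rank_in L y = i}"
    let ?fx = "\<lambda>d. if last d \<le> x then f d else 0"
    have fx: "?fx \<in> carrier (free_space (flags (below L x) i))"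
      by (auto simp: mem_stalk_cochains_iff f_def)
    have "k y \<in> flag_relations (below L x) i" if y: "y \<in> ?Y" for y
    proof -
      have yV: "y \<in> V"
        using down[OF x] y by blast
      have "(\<lambda>d. if last d \<le> y then e x d else 0) \<in> carrier (free_space (flags (below L y) i))"
        using e[OF x] y by (auto simp: mem_stalk_cochains_iff)
      moreover have "flag_class i y (\<lambda>d. if last d \<le> y then e x d else 0) = flag_class i y (e y)"
      proof -
        have "flag_projection L i x y (s x) = s y"
          using s x yV y by (simp add: sections_def)
        with y show ?thesis
          by (simp add: se x yV flag_projection_class[OF _ e[OF x]])
      qed
      ultimately have "k y \<in> flag_relations (below L y) i"
        unfolding k_def using coset_eq_iff[OF submodule_stalk _ e[OF yV]] by blast
      with y flag_relations_mono show ?thesis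
        by blast
    qed
    then have "(\<lambda>d. \<Sum>y\<in>?Y. k y d) \<in> flag_relations (below L x) i"
      by (rule submodule_free_sum[OF submodule_stalk])
    moreover have "(\<Sum>y\<in>?Y. k y d) = e x d - ?fx d" for d
    proof (cases "d \<in> flags L i \<and> last d \<le> x")
      case True
      then have last: "last d \<in> ?Y"
        by (auto simp: last_flag[of d L i] flags_iff)
      then have "last d \<in> V"
        using down[OF x] by blast
      have "k y d = (if y = last d then e x d - ?fx d else 0)" if y: "y \<in> ?Y" for y
      proof (cases "y = last d")
        case True
        then show ?thesis
          using \<open>last d \<in> V\<close> \<open>d \<in> flags L i \<and> last d \<le> x\<close> by (simp add: k_def f_def)
      next
        case False
        \<comment> \<open>Different elements of the same rank are incomparable, so a flag meets only
          the summand of its own top.\<close>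
        then have "\<not> last d \<le> y"
          using rank_strict_mono[OF fin, of "last d" y] last y by (auto simp: less_le)
        moreover have "y \<in> V"
          using down[OF x] y by blast
        ultimately show ?thesis
          using False e by (simp add: k_def mem_stalk_cochains_iff)
      qed
      then have "(\<Sum>y\<in>?Y. k y d) = (\<Sum>y\<in>?Y. if y = last d then e x d - ?fx d else 0)"
        by (rule sum.cong[OF refl])
      also have "\<dots> = e x d - ?fx d"
        using fin last by (subst sum.delta) auto
      finally show ?thesis .
    next
      case False
      then have "k y d = 0" if "y \<in> ?Y" for y
        using that e[OF x] e[of y] down[OF x, of y] by (auto simp: k_def mem_stalk_cochains_iff dest: order.trans)
      moreover have "e x d - ?fx d = 0"
        using False e[OF x] fx by (simp add: mem_stalk_cochains_iff)
      ultimately show ?thesis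
        by simp
    qed
    ultimately have "(\<lambda>d. e x d - ?fx d) \<in> flag_relations (below L x) i"
      by simp
    then show "s x = flag_class i x ?fx"
      using coset_eq_iff[OF submodule_stalk e[OF x] fx] se[OF x] by simp
  qed (simp add: f_def)
qed

lemma flasque_flag_sheaf: "flasque L (flag_sheaf L i)"
  unfolding flasque_def
proof (intro allI impI equalityI)
  fix U V assume V: "order_ideal L V" and VU: "V \<subseteq> U"
  show "(\<lambda>s. restrict s V) ` sections (flag_sheaf L i) U \<subseteq> sections (flag_sheaf L i) V"
    using VU by (auto simp: sections_def subset_iff)
  show "sections (flag_sheaf L i) V \<subseteq> (\<lambda>s. restrict s V) ` sections (flag_sheaf L i) U"
  proof
    fix s assume s: "s \<in> sections (flag_sheaf L i) V"
    obtain f where f: "\<And>c. c \<notin> flags L i \<Longrightarrow> f c = 0"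
      and sf: "\<And>x. x \<in> V \<Longrightarrow> s x = flag_class i x (\<lambda>d. if last d \<le> x then f d else 0)"
      using flag_sheaf_section_cochain[OF V s] by blast
    \<comment> \<open>Truncations of one cochain are compatible under all restriction maps, so they
      form a section over any ideal.\<close>
    define t where "t = (\<lambda>x\<in>U. flag_class i x (\<lambda>d. if last d \<le> x then f d else 0))"
    have fx: "(\<lambda>d. if last d \<le> x then f d else 0) \<in> carrier (free_space (flags (below L x) i))" for x
      using f by (auto simp: mem_stalk_cochains_iff)
    have "t \<in> sections (flag_sheaf L i) U"
      unfolding sections_def
    proof (intro CollectI conjI ballI impI)
      show "t \<in> (\<Pi>\<^sub>E x\<in>U. carrier (stalk (flag_sheaf L i) x))"
        using fx by (auto simp: t_def carrier_quotient[OF submodule_stalk])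
      fix x y assume xy: "x \<in> U" "y \<in> U" "x \<le> y"
      have "(\<lambda>d. if last d \<le> x then if last d \<le> y then f d else 0 else 0)
          = (\<lambda>d. if last d \<le> x then f d else 0)"
        by (intro ext) (auto dest: order.trans[OF _ xy(3)])
      with xy show "res (flag_sheaf L i) y x (t y) = t x"
        by (simp add: t_def flag_projection_class[OF _ fx])
    qed
    moreover have "restrict t V = s"
    proof
      fix x
      show "restrict t V x = s x"
        using s sf VU by (cases "x \<in> V") (auto simp: t_def sections_def PiE_def extensional_def)
    qed
    ultimately show "s \<in> (\<lambda>s. restrict s V) ` sections (flag_sheaf L i) U"
      by blast
  qed
qed

end

section \<open>The augmented complex\<close>

context
  fixes L :: "'a::order set"
  assumes lgs: "locally_geometric_semilattice L"
begin

lemma finite_lgs: "finite L"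
  using lgs by (simp add: locally_geometric_semilattice_def)

lemma bottom_of_lgs: "bottom_of L \<in> L" "y \<in> L \<Longrightarrow> bottom_of L \<le> y"
proof -
  obtain b where b: "b \<in> L" "\<forall>y\<in>L. b \<le> y"
    using lgs by (auto simp: locally_geometric_semilattice_def)
  then have "bottom_of L = b"
    unfolding bottom_of_def by (intro Least_equality) auto
  with b show "bottom_of L \<in> L" "y \<in> L \<Longrightarrow> bottom_of L \<le> y"
    by auto
qed

lemma rank_zero_iff:
  assumes "y \<in> L"
  shows "rank_in L y = 0 \<longleftrightarrow> y = bottom_of L"
proof -
  obtain C where "C \<subseteq> {y \<in> L. y < bottom_of L}" "card C = rank_in L (bottom_of L)"
    by (rule rank_chainE[OF finite_lgs])
  moreover have "\<not> z < bottom_of L" if "z \<in> L" for z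
    using bottom_of_lgs(2)[OF that] by (simp add: less_le_not_le)
  then have "{y \<in> L. y < bottom_of L} = {}"
    by blast
  ultimately have "rank_in L (bottom_of L) = 0"
    by auto
  moreover have "0 < rank_in L y" if "y \<noteq> bottom_of L"
    using rank_strict_mono[OF finite_lgs bottom_of_lgs(1), of y] bottom_of_lgs(2)[OF assms] that
    by (simp add: less_le)
  ultimately show ?thesis
    by (cases "y = bottom_of L") auto
qed

lemma flags_below_zero:
  assumes "x \<in> L"
  shows "flags (below L x) 0 = {[bottom_of L]}"
proof -
  have "c \<in> flags L 0 \<longleftrightarrow> c = [bottom_of L]" for c
  proof -
    have "[y] \<in> flags L 0 \<longleftrightarrow> y \<in> L \<and> rank_in L y = 0" for y
      by (simp add: flags_iff)
    then have "[y] \<in> flags L 0 \<longleftrightarrow> y = bottom_of L" for y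
      using bottom_of_lgs(1) rank_zero_iff by metis
    moreover have "\<exists>y. c = [y]" if "c \<in> flags L 0"
      using length_flag[OF that] by (simp add: length_Suc_conv)
    ultimately show ?thesis
      by blast
  qed
  then have "{c \<in> flags L 0. last c \<le> x} = {[bottom_of L]}"
    using bottom_of_lgs(2)[OF assms] by fastforce
  then show ?thesis
    by (simp only: flags_below[OF finite_lgs])
qed

text \<open>The bottom offers no atom for a homotopy; exactness there in positive degrees holds
  because there are no flags at all.\<close>

lemma flags_below_bottom: "flags (below L (bottom_of L)) (Suc i) = {}"
proof -
  have False if c: "c \<in> flags L (Suc i)" "last c \<le> bottom_of L" for c
  proof -
    have "last c \<in> L" "rank_in L (last c) = Suc i"
      using c(1) by (auto simp: last_flag[OF c(1)] flags_iff)
    with c(2) bottom_of_lgs(2)[of "last c"] show False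
      using rank_zero_iff[of "last c"] by auto
  qed
  then show ?thesis
    by (auto simp: flags_below[OF finite_lgs])
qed

text \<open>An atom \<open>a\<close> not below \<open>u\<close> meets \<open>u\<close> in the
  bottom. Semimodularity then turns "\<open>a\<close> covers the bottom" into "the join covers
  \<open>u\<close>", so the rank rises by exactly one.\<close>

lemma join_with_atom_exists:
  assumes x: "x \<in> L" "x \<noteq> bottom_of L"
  defines "P \<equiv> below L x"
  shows "\<exists>a J. atom_join P a J"
proof -
  let ?b = "bottom_of L"
  have "geometric_lattice_on P"
    using lgs x by (simp add: locally_geometric_semilattice_def P_def)
  then have lat: "finite_lattice_on P" and semi: "semimodular_on P"
    by (simp_all add: geometric_lattice_on_def)
  note fin = finite_of_lattice[OF lat semi]
  have b: "?b \<in> P" "\<And>y. y \<in> P \<Longrightarrow> ?b \<le> y"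
    using bottom_of_lgs x(1) by (auto simp: P_def below_def)
  have "finite {y \<in> P. ?b < y}"
    using fin by simp
  moreover have "x \<in> {y \<in> P. ?b < y}"
    using x bottom_of_lgs(2)[OF x(1)] by (auto simp: P_def below_def less_le)
  ultimately obtain a where a: "a \<in> P" "?b < a" "\<forall>y\<in>{y \<in> P. ?b < y}. y \<le> a \<longrightarrow> a = y"
    using finite_has_minimal[of "{y \<in> P. ?b < y}"] by blast
  then have atom: "covers_in P ?b a"
    using b(1) by (auto simp: covers_in_def less_le)
  define J where "J u = (SOME j. isLub P {a, u} j)" for u
  have lub: "isLub P {a, u} (J u)" if "u \<in> P" for u
    unfolding J_def using lub_exists[OF lat semi a(1) that] by (rule someI_ex)
  note lub' = lub[unfolded isLub_pair_iff[OF fin]]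
  have cov: "covers_in P u (J u)" if u: "u \<in> P" "\<not> a \<le> u" for u
  proof (rule covers_join[OF lat semi a(1) u(1) _ lub[OF u(1)] atom])
    have "z \<le> ?b" if "z \<in> P" "z \<le> a" "z \<le> u" for z
    proof (rule ccontr)
      assume "\<not> z \<le> ?b"
      with b(2)[OF that(1)] have "?b < z"
        by (auto simp: less_le)
      with a(3) that u(2) show False
        by auto
    qed
    with b a(1) u(1) show "isGlb P {a, u} ?b"
      by (simp add: isGlb_pair_iff[OF fin])
  qed
  have rank: "rank_in P (J u) = Suc (rank_in P u)" if "u \<in> P" "\<not> a \<le> u" for u
    by (rule rank_covers[OF lat semi b cov[OF that]])
  have "atom_join P a J"
    unfolding atom_join_def
  \<comment> \<open>The instantiated \<open>conjI\<close> splits the four clauses but leaves the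
    conjunction inside the first one whole.\<close>
  proof (intro conjI[of "\<forall>u\<in>P. _ u"] ballI impI)
    fix u assume "u \<in> P" "\<not> a \<le> u"
    with cov lub' rank show "J u \<in> P \<and> u < J u \<and> a \<le> J u \<and> rank_in P (J u) = Suc (rank_in P u)"
      by (simp add: covers_in_def)
  next
    fix u w assume uw: "u \<in> P" "w \<in> P" "u < w" "\<not> a \<le> w"
    then have "\<not> a \<le> u"
      by (meson less_imp_le order.trans)
    have "u \<le> J w" "a \<le> J w" "J w \<in> P"
      using lub'[OF uw(2)] uw(3) by auto
    then have "J u \<le> J w"
      using lub'[OF uw(1)] by blast
    \<comment> \<open>Joining with \<open>a\<close> is only weakly monotone in general; here it
      raises both ranks by one, which excludes equality.\<close>
    moreover have "rank_in P (J u) < rank_in P (J w)"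
      using rank[OF uw(1) \<open>\<not> a \<le> u\<close>] rank[OF uw(2,4)] rank_strict_mono[OF fin uw(1,3)] by simp
    ultimately show "J u < J w"
      by (auto simp: less_le)
  next
    fix u w assume uw: "u \<in> P" "w \<in> P" "u < w" "\<not> a \<le> u" "a \<le> w"
      and "rank_in P w = Suc (rank_in P u)"
    then have "rank_in P (J u) = rank_in P w"
      using rank by simp
    moreover have "J u \<le> w" "J u \<in> P"
      using lub'[OF uw(1)] uw by auto
    ultimately show "J u = w"
      \<comment> \<open>An element below \<open>w\<close> and of the same rank is
        \<open>w\<close>.\<close>
      using rank_strict_mono[OF fin, of "J u" w] by (auto simp: less_le)
  next
    fix u assume u: "u \<in> P" "rank_in P u = 0"
    show "\<not> a \<le> u"
      using rank_strict_mono[OF fin b(1), of u] u order.strict_trans2[OF a(2), of u] by auto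
  qed
  then show ?thesis
    by blast
qed

lemma flag_complex_exact_below:
  assumes x: "x \<in> L" and f: "f \<in> carrier (free_space (flags (below L x) (Suc n)))"
    and df: "flag_delta (below L x) (Suc n) f \<in> flag_relations (below L x) (Suc (Suc n))"
  shows "\<exists>w\<in>carrier (free_space (flags (below L x) n)).
    (\<lambda>c. f c - flag_delta (below L x) n w c) \<in> flag_relations (below L x) (Suc n)"
proof (cases "x = bottom_of L")
  case True
  note fin = finite_below[OF finite_lgs]
  have "(\<lambda>_. 0) \<in> carrier (free_space (flags (below L x) n))"
    by (simp add: mem_flag_cochains_iff[OF fin])
  moreover have "f c = 0" for c
    using f[unfolded mem_flag_cochains_iff[OF fin]] by (simp add: True flags_below_bottom)
  ultimately show ?thesis
    using submodule_free_zero[OF submodule_flag_relations[OF fin]]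
    by (intro bexI[of _ "\<lambda>_. 0"]) (simp_all add: flag_delta_apply[OF fin] cong: if_cong)
next
  case False
  obtain a J where "atom_join (below L x) a J"
    using join_with_atom_exists[OF x False] by blast
  from flag_complex_exact[OF finite_below[OF finite_lgs] this f df] show ?thesis .
qed

lemma flag_delta_zero_injective_below:
  assumes x: "x \<in> L" "x \<noteq> bottom_of L" and f: "f \<in> carrier (free_space (flags (below L x) 0))"
    and df: "flag_delta (below L x) 0 f \<in> flag_relations (below L x) (Suc 0)"
  shows "f \<in> flag_relations (below L x) 0"
proof -
  obtain a J where "atom_join (below L x) a J"
    using join_with_atom_exists[OF x] by blast
  from flag_delta_zero_injective[OF finite_below[OF finite_lgs] this f df] show ?thesis .
qed

section \<open>The sheaf supported at the bottom and its augmentation\<close>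

lemma sheaf_on_bottom_sheaf: "sheaf_on L (bottom_sheaf L)"
  unfolding sheaf_on_def
proof (intro conjI ballI impI)
  fix x
  show "Module.module rat_field (stalk (bottom_sheaf L) x)"
    by (rule moduleI[OF cring_rat_field abelian_groupI])
      (auto simp: bottom_sheaf_def rat_field_def algebra_simps intro: exI[of _ "- q" for q])
next
  fix x y assume "x \<in> L" "y \<in> L" "x \<le> y"
  then show "linear_map (stalk (bottom_sheaf L) y) (stalk (bottom_sheaf L) x) (res (bottom_sheaf L) y x)"
    by (auto simp: linear_map_def bottom_sheaf_def)
next
  fix x s
  show "res (bottom_sheaf L) x x s = s"
    by (simp add: bottom_sheaf_def)
next
  fix x y z s assume "x \<in> L" "x \<le> y" "y \<le> z" "s \<in> carrier (stalk (bottom_sheaf L) z)"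
  then show "res (bottom_sheaf L) y x (res (bottom_sheaf L) z y s) = res (bottom_sheaf L) z x s"
    by (auto simp: bottom_sheaf_def)
qed

lemma augmentation_eq:
  "augmentation L x q = flag_class L 0 x (\<lambda>c. q * basis_vec [bottom_of L] c)"
  by (simp add: augmentation_def)

lemma basis_bottom_in:
  "x \<in> L \<Longrightarrow> (\<lambda>c. q * basis_vec [bottom_of L] c) \<in> carrier (free_space (flags (below L x) 0))"
  unfolding mem_flag_cochains_iff[OF finite_below[OF finite_lgs]]
  by (simp add: flags_below_zero basis_vec_def)

lemma sheaf_hom_augmentation: "sheaf_hom L (bottom_sheaf L) (flag_sheaf L 0) (augmentation L)"
  unfolding sheaf_hom_def
proof (intro conjI ballI impI)
  note sub = submodule_stalk[OF finite_lgs]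
  fix x assume x: "x \<in> L"
  show "linear_map (stalk (bottom_sheaf L) x) (stalk (flag_sheaf L 0) x) (augmentation L x)"
    unfolding linear_map_def augmentation_eq flag_sheaf_sel[OF finite_lgs]
    using basis_bottom_in[OF x]
    by (auto simp: carrier_quotient[OF sub] add_coset[OF sub] smult_coset[OF sub] bottom_sheaf_def
        distrib_right mult.assoc)
next
  fix x y s assume xy: "x \<in> L" "y \<in> L" "x \<le> y" and s: "s \<in> carrier (stalk (bottom_sheaf L) y)"
  \<comment> \<open>Either \<open>y\<close> is the bottom and then \<open>x = y\<close>, or the
    stalk at \<open>y\<close> is zero and \<open>s = 0\<close>.\<close>
  have "res (bottom_sheaf L) y x s = s"
  proof (cases "y = bottom_of L")
    case True
    with xy bottom_of_lgs(2)[OF xy(1)] show ?thesis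
      by (simp add: bottom_sheaf_def)
  next
    case False
    with s show ?thesis
      by (simp add: bottom_sheaf_def)
  qed
  moreover have "(\<lambda>d. if last d \<le> x then s * basis_vec [bottom_of L] d else 0)
      = (\<lambda>d. s * basis_vec [bottom_of L] d)"
    using bottom_of_lgs(2)[OF xy(1)] by (auto simp: basis_vec_def)
  ultimately show "augmentation L x (res (bottom_sheaf L) y x s)
      = res (flag_sheaf L 0) y x (augmentation L y s)"
    using flag_projection_class[OF finite_lgs xy(3) basis_bottom_in[OF xy(2)], of s]
    by (simp add: augmentation_eq flag_sheaf_sel[OF finite_lgs])
qed

section \<open>Exactness on stalks\<close>

lemma kernel_augmentation:
  assumes x: "x \<in> L"
  shows "a_kernel (stalk (bottom_sheaf L) x) (stalk (flag_sheaf L 0) x) (augmentation L x) = {0}"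
proof -
  note sub = submodule_stalk[OF finite_lgs]
  have "augmentation L x q = flag_relations (below L x) 0 \<longleftrightarrow> q = 0" for q
  proof -
    have "augmentation L x q = flag_relations (below L x) 0 \<longleftrightarrow>
        (\<lambda>c. q * basis_vec [bottom_of L] c) = (\<lambda>_. 0)"
      unfolding augmentation_eq coset_eq_self_iff[OF sub basis_bottom_in[OF x]]
      by (simp add: flag_relations_trivial[OF finite_below[OF finite_lgs]])
    also have "\<dots> \<longleftrightarrow> q = 0"
      by (auto simp: basis_vec_def fun_eq_iff)
    finally show ?thesis .
  qed
  then show ?thesis
    by (auto simp: a_kernel_def' flag_sheaf_sel[OF finite_lgs] zero_quotient[OF sub] bottom_sheaf_def)
qed

lemma kernel_differential:
  "a_kernel (stalk (flag_sheaf L i) x) (stalk (flag_sheaf L (Suc i)) x) (flag_sheaf_differential L i x)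
   = flag_class L i x ` {f \<in> carrier (free_space (flags (below L x) i)).
       flag_delta (below L x) i f \<in> flag_relations (below L x) (Suc i)}"
proof -
  note sub = submodule_stalk[OF finite_lgs] and fin = finite_below[OF finite_lgs]
  have "flag_sheaf_differential L i x (flag_class L i x f) = flag_relations (below L x) (Suc i)
      \<longleftrightarrow> flag_delta (below L x) i f \<in> flag_relations (below L x) (Suc i)"
    if "f \<in> carrier (free_space (flags (below L x) i))" for f
    using coset_eq_self_iff[OF sub linear_map_in[OF linear_map_flag_delta[OF fin] that]]
    by (simp add: flag_sheaf_differential_class[OF finite_lgs that])
  then show ?thesis
    by (auto simp: a_kernel_def' flag_sheaf_sel[OF finite_lgs] zero_quotient[OF sub] carrier_quotient[OF sub])
qed

text \<open>At the bottom the stalk of degree 0 is spanned by the one-element chain and \<delta>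
  vanishes. Elsewhere the augmentation starts from zero, and the homotopy makes \<delta> injective
  in degree 0.\<close>

lemma image_augmentation:
  assumes x: "x \<in> L"
  shows "augmentation L x ` carrier (stalk (bottom_sheaf L) x)
    = a_kernel (stalk (flag_sheaf L 0) x) (stalk (flag_sheaf L (Suc 0)) x) (flag_sheaf_differential L 0 x)"
proof -
  note sub = submodule_stalk[OF finite_lgs] and fin = finite_below[OF finite_lgs]
  let ?e = "\<lambda>q c. q * basis_vec [bottom_of L] c"
  show ?thesis
  proof (cases "x = bottom_of L")
    case True
    have "flag_delta (below L x) 0 f \<in> flag_relations (below L x) (Suc 0)" for f
    proof -
      have "flag_delta (below L x) 0 f = (\<lambda>_. 0)"
        by (auto simp: flag_delta_apply[OF fin] True flags_below_bottom)
      then show ?thesis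
        using submodule_free_zero[OF sub] by simp
    qed
    moreover have "carrier (free_space (flags (below L x) 0)) = range ?e"
    proof (intro equalityI subsetI)
      fix f assume "f \<in> carrier (free_space (flags (below L x) 0))"
      then have "f = ?e (f [bottom_of L])"
        unfolding mem_flag_cochains_iff[OF fin] by (auto simp: flags_below_zero[OF x] basis_vec_def)
      then show "f \<in> range ?e"
        by blast
    qed (use basis_bottom_in[OF x] in auto)
    ultimately show ?thesis
      using True by (auto simp: kernel_differential augmentation_eq bottom_sheaf_def image_image)
  next
    case False
    have z: "(\<lambda>_. 0) \<in> carrier (free_space (flags (below L x) 0))"
      by (simp add: mem_flag_cochains_iff[OF fin])
    have "flag_delta (below L x) 0 (\<lambda>_. 0) = (\<lambda>_. 0)"
      by (auto simp: flag_delta_apply[OF fin])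
    then have "flag_delta (below L x) 0 (\<lambda>_. 0) \<in> flag_relations (below L x) (Suc 0)"
      using submodule_free_zero[OF sub] by simp
    moreover have "f = (\<lambda>_. 0)"
      if "f \<in> carrier (free_space (flags (below L x) 0))"
        "flag_delta (below L x) 0 f \<in> flag_relations (below L x) (Suc 0)" for f
      using flag_delta_zero_injective_below[OF x False that] by (simp add: flag_relations_trivial[OF fin])
    ultimately have "{f \<in> carrier (free_space (flags (below L x) 0)).
       flag_delta (below L x) 0 f \<in> flag_relations (below L x) (Suc 0)} = {\<lambda>_. 0}"
      using z by blast
    then show ?thesis
      using False by (simp add: kernel_differential augmentation_eq bottom_sheaf_def)
  qed
qed

lemma image_differential:
  assumes x: "x \<in> L"
  shows "flag_sheaf_differential L n x ` carrier (stalk (flag_sheaf L n) x)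
    = a_kernel (stalk (flag_sheaf L (Suc n)) x) (stalk (flag_sheaf L (Suc (Suc n))) x)
        (flag_sheaf_differential L (Suc n) x)"
proof -
  note sub = submodule_stalk[OF finite_lgs] and fin = finite_below[OF finite_lgs]
  note d = linear_map_in[OF linear_map_flag_delta[OF fin]]
  show ?thesis
    unfolding kernel_differential
  proof (intro equalityI subsetI)
    fix X assume "X \<in> flag_sheaf_differential L n x ` carrier (stalk (flag_sheaf L n) x)"
    then obtain f where f: "f \<in> carrier (free_space (flags (below L x) n))"
      and "X = flag_class L (Suc n) x (flag_delta (below L x) n f)"
      by (auto simp: flag_sheaf_sel[OF finite_lgs] carrier_quotient[OF sub]
          flag_sheaf_differential_class[OF finite_lgs])
    with d[OF f] show "X \<in> flag_class L (Suc n) x ` {f \<in> carrier (free_space (flags (below L x) (Suc n))).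
       flag_delta (below L x) (Suc n) f \<in> flag_relations (below L x) (Suc (Suc n))}"
      using flag_delta_delta_in_relations[OF fin] by blast
  next
    fix X assume "X \<in> flag_class L (Suc n) x ` {f \<in> carrier (free_space (flags (below L x) (Suc n))).
       flag_delta (below L x) (Suc n) f \<in> flag_relations (below L x) (Suc (Suc n))}"
    then obtain f where f: "f \<in> carrier (free_space (flags (below L x) (Suc n)))"
      "flag_delta (below L x) (Suc n) f \<in> flag_relations (below L x) (Suc (Suc n))"
      and X: "X = flag_class L (Suc n) x f"
      by blast
    obtain w where w: "w \<in> carrier (free_space (flags (below L x) n))"
      and fw: "(\<lambda>c. f c - flag_delta (below L x) n w c) \<in> flag_relations (below L x) (Suc n)"
      using flag_complex_exact_below[OF x f] by blast
    have "X = flag_sheaf_differential L n x (flag_class L n x w)"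
      unfolding X flag_sheaf_differential_class[OF finite_lgs w] coset_eq_iff[OF sub f(1) d[OF w]]
      by (rule fw)
    with w show "X \<in> flag_sheaf_differential L n x ` carrier (stalk (flag_sheaf L n) x)"
      by (simp add: flag_sheaf_sel[OF finite_lgs] carrier_quotient[OF sub])
  qed
qed

text \<open>A flag of degree \<open>Suc r\<close> would contain an element of rank greater than
  \<open>r\<close>. This brings the last place of the complex into the same kernel form as the
  others.\<close>

lemma kernel_differential_top:
  assumes x: "x \<in> L" and r: "r = Max (rank_in L ` L)"
  shows "a_kernel (stalk (flag_sheaf L r) x) (stalk (flag_sheaf L (Suc r)) x)
    (flag_sheaf_differential L r x) = carrier (stalk (flag_sheaf L r) x)"
proof -
  note sub = submodule_stalk[OF finite_lgs] and fin = finite_below[OF finite_lgs]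
  have "rank_in L y \<le> r" if "y \<in> L" for y
    unfolding r using that finite_lgs by (intro Max_ge) auto
  then have "c \<notin> flags L (Suc r)" for c
    by (auto simp: flags_iff) (metis Suc_n_not_le_n order_refl)
  then have "flag_delta (below L x) r f = (\<lambda>_. 0)" for f
    by (auto simp: flag_delta_apply[OF fin] flags_below[OF finite_lgs])
  then show ?thesis
    unfolding kernel_differential using submodule_free_zero[OF sub]
    by (simp add: flag_sheaf_sel[OF finite_lgs] carrier_quotient[OF sub])
qed

end

theorem proposition3p2p6:
  fixes L :: "'a::order set" and r :: nat
  assumes "locally_geometric_semilattice L"
    and "r = Max (rank_in L ` L)"
  shows "sheaf_complex L (flag_sheaf L) (flag_sheaf_differential L) \<and>
         sheaf_on L (bottom_sheaf L) \<and>
         sheaf_hom L (bottom_sheaf L) (flag_sheaf L 0) (augmentation L) \<and>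
         (\<forall>i\<le>r. flasque L (flag_sheaf L i)) \<and>
         exact_augmented L r (bottom_sheaf L) (augmentation L)
           (flag_sheaf L) (flag_sheaf_differential L)"
proof (intro conjI allI impI)
  note fin = finite_lgs[OF assms(1)]
  show "sheaf_complex L (flag_sheaf L) (flag_sheaf_differential L)"
    by (rule sheaf_complex_flag_sheaf[OF fin])
  show "sheaf_on L (bottom_sheaf L)"
    by (rule sheaf_on_bottom_sheaf[OF assms(1)])
  show "sheaf_hom L (bottom_sheaf L) (flag_sheaf L 0) (augmentation L)"
    by (rule sheaf_hom_augmentation[OF assms(1)])
  show "flasque L (flag_sheaf L i)" for i
    by (rule flasque_flag_sheaf[OF fin])
  \<comment> \<open>Image equals kernel in every degree; at \<open>i = r\<close> the kernel is the
    whole stalk, also when \<open>r = 0\<close>.\<close>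
  have "(if i = 0 then augmentation L x ` carrier (stalk (bottom_sheaf L) x)
         else flag_sheaf_differential L (i - 1) x ` carrier (stalk (flag_sheaf L (i - 1)) x))
      = (if i = r then carrier (stalk (flag_sheaf L i) x)
         else a_kernel (stalk (flag_sheaf L i) x) (stalk (flag_sheaf L (Suc i)) x)
           (flag_sheaf_differential L i x))" if x: "x \<in> L" for i x
    using image_augmentation[OF assms(1) x] image_differential[OF assms(1) x, of "i - 1"]
      kernel_differential_top[OF assms(1) x assms(2)]
    by (cases "i = 0") auto
  moreover have "\<zero>\<^bsub>stalk (bottom_sheaf L) x\<^esub> = 0" for x
    by (simp add: bottom_sheaf_def)
  ultimately show "exact_augmented L r (bottom_sheaf L) (augmentation L)
      (flag_sheaf L) (flag_sheaf_differential L)"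
    using kernel_augmentation[OF assms(1)] by (simp add: exact_augmented_def)
qed

end
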